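(* Let $a,d\in\mathbb{Z}$ with $ad\neq 0$, let $f(x)=x^4+ax^3+d$, and let $\delta=256d-27a^4$. Suppose that $f(x)$ is monogenic, and let $\mathrm{Gal}(f)$ denote the Galois group of $f(x)$ over $\mathbb{Q}$. Then: \begin{enumerate} \item $\mathrm{Gal}(f)\simeq D_4$ if and only if $(a,d)=(2,2)$ or $(a,d)=(-2,2)$; \item $\mathrm{Gal}(f)\simeq A_4$ if and only if $\delta$ is a square (in $\mathbb{Z}$); \item $\mathrm{Gal}(f)\simeq S_4$ if and only if $\delta$ is not a square (in $\mathbb{Z}$) and $(a,d)\notin\{(2,2),(-2,2)\}$. \end{enumerate}
   Context: A monic polynomial $f(x)\in\mathbb{Z}[x]$ of degree 4 is called monogenic if $f(x)$ is irreducible over $\mathbb{Q}$ and, for $\theta$ with $f(\theta)=0$ and $K=\mathbb{Q}(\theta)$, the set $\{1,\theta,\theta^2,\theta^3\}$ is a $\mathbb{Z}$-basis of the ring of integers $\mathbb{Z}_K$ of $K$ (equivalently, $\mathbb{Z}_K=\mathbb{Z}[\theta]$). The Galois group $\mathrm{Gal}(f)$ of $f$ over $\mathbb{Q}$ is the Galois group over $\mathbb{Q}$ of the splitting field of $f$. $D_4$ is the dihedral group of order 8, $A_4$ the alternating group of order 12, and $S_4$ the symmetric group of order 24. *)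

theory Defs
  imports "HOL-Algebra.Algebraic_Closure_Type" "HOL-Algebra.Generated_Fields" "HOL-Algebra.Sym_Groups" "HOL-Algebra.Bij"
begin

abbreviation complex_ring :: "complex ring"
  where "complex_ring \<equiv> ring_of_type_algebra"

definition rat_adjoin :: "complex set \<Rightarrow> complex set"
  where "rat_adjoin S = generate_field complex_ring (\<rat> \<union> S)"

definition complex_roots :: "int poly \<Rightarrow> complex set"
  where "complex_roots f = {z. poly (map_poly of_int f) z = 0}"

definition ring_of_integers :: "complex set \<Rightarrow> complex set"
  where "ring_of_integers K = {z \<in> K. algebraic_int z}"

definition int_scale :: "int \<Rightarrow> complex \<Rightarrow> complex"
  where "int_scale c z = of_int c * z"

interpretation int_mod: Modules.module int_scale
  by unfold_locales (simp_all add: int_scale_def algebra_simps)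

definition int_basis :: "complex set \<Rightarrow> complex set \<Rightarrow> bool"
  where "int_basis B M \<longleftrightarrow> int_mod.independent B \<and> int_mod.span B = M"

text \<open>
  The power basis is given as a set.  Nothing is lost by this: the powers of a root of \<open>f\<close> with
  exponent below the degree are pairwise distinct, since \<open>f\<close> is irreducible over the rationals.
\<close>

definition monogenic :: "int poly \<Rightarrow> bool"
  where "monogenic f \<longleftrightarrow>
    Polynomial.lead_coeff f = 1 \<and>
    Factorial_Ring.irreducible (map_poly rat_of_int f) \<and>
    (\<forall>\<theta> \<in> complex_roots f.
       int_basis {\<theta> ^ i | i. i < Polynomial.degree f} (ring_of_integers (rat_adjoin {\<theta>})))"

definition rat_automorphisms :: "complex set \<Rightarrow> (complex \<Rightarrow> complex) set"
  where "rat_automorphisms K =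
    {\<sigma> \<in> Bij K. \<sigma> \<in> ring_hom (complex_ring\<lparr>carrier := K\<rparr>) (complex_ring\<lparr>carrier := K\<rparr>) \<and>
       (\<forall>q\<in>\<rat>. \<sigma> q = q)}"

definition splitting_field :: "int poly \<Rightarrow> complex set"
  where "splitting_field f = rat_adjoin (complex_roots f)"

text \<open>
  As in \<open>AutoGroup\<close>, automorphisms are extensional functions (undefined outside the field), so that
  each automorphism of the splitting field is counted once.
\<close>

definition galois_group :: "int poly \<Rightarrow> (complex \<Rightarrow> complex) monoid"
  where "galois_group f =
    (BijGroup (splitting_field f))\<lparr>carrier := rat_automorphisms (splitting_field f)\<rparr>"

text \<open>
  The dihedral group of order \<open>2n\<close>: the pair \<open>(i, e)\<close> stands for the map \<open>x \<mapsto> i + e x\<close> on the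
  integers modulo \<open>n\<close>, so \<open>(1, 1)\<close> is a rotation of order \<open>n\<close> and each \<open>(i, -1)\<close> is a reflection.
\<close>

definition dihedral_group :: "nat \<Rightarrow> (int \<times> int) monoid"
  where "dihedral_group n =
    \<lparr>carrier = {0..<int n} \<times> {1, -1},
     monoid.mult = (\<lambda>(i, e) (j, f). ((i + e * j) mod int n, e * f)),
     one = (0, 1)\<rparr>"

lemma order_dihedral_group: "Coset.order (dihedral_group n) = 2 * n"
  by (simp add: Coset.order_def dihedral_group_def)

lemma group_dihedral_group:
  assumes "n > 0"
  shows "group (dihedral_group n)"
proof (rule groupI)
  fix x assume "x \<in> carrier (dihedral_group n)"
  then obtain i e where x: "x = (i, e)" "0 \<le> i" "i < int n" "e = 1 \<or> e = -1"
    by (auto simp: dihedral_group_def)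
  show "\<exists>y\<in>carrier (dihedral_group n). y \<otimes>\<^bsub>dihedral_group n\<^esub> x = \<one>\<^bsub>dihedral_group n\<^esub>"
    using x assms
    by (intro bexI[of _ "((- e * i) mod int n, e)"])
       (auto simp: dihedral_group_def mod_add_left_eq)
qed (use assms in \<open>auto simp: dihedral_group_def algebra_simps mod_simps\<close>)

lemma subfield_rat_adjoin: "subfield (rat_adjoin S) complex_ring"
proof -
  interpret C: field complex_ring by (rule field_from_type_algebra)
  show ?thesis unfolding rat_adjoin_def
    by (rule C.generate_field_is_subfield) (simp add: ring_of_type_algebra_def)
qed

lemma group_galois_group: "group (galois_group f)"
proof -
  define K where "K = splitting_field f"
  define R where "R = complex_ring\<lparr>carrier := K\<rparr>"
  interpret C: field complex_ring by (rule field_from_type_algebra)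
  have sub: "subfield K complex_ring"
    unfolding K_def splitting_field_def by (rule subfield_rat_adjoin)
  then interpret R: field R
    unfolding R_def by (rule C.subfield_iff(2))
  have cR: "carrier R = K" by (simp add: R_def)
  have rat: "\<rat> \<subseteq> K"
    unfolding K_def splitting_field_def rat_adjoin_def by (auto intro: generate_field.incl)
  have carr: "rat_automorphisms K = {\<sigma> \<in> Bij K. \<sigma> \<in> ring_hom R R \<and> (\<forall>q\<in>\<rat>. \<sigma> q = q)}"
    by (simp add: rat_automorphisms_def R_def)
  interpret B: group "BijGroup K" by (rule group_BijGroup)
  have "subgroup (rat_automorphisms K) (BijGroup K)"
  proof (rule B.subgroupI)
    show "rat_automorphisms K \<subseteq> carrier (BijGroup K)"
      by (auto simp: carr BijGroup_def)
    have "(\<lambda>x\<in>K. x) \<in> rat_automorphisms K"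
      using rat R.m_closed R.a_closed R.one_closed
      unfolding carr by (auto simp: id_Bij ring_hom_def cR)
    then show "rat_automorphisms K \<noteq> {}" by blast
  next
    fix s assume s: "s \<in> rat_automorphisms K"
    have sB: "s \<in> Bij K" and hom: "s \<in> ring_hom R R" and fixQ: "\<forall>q\<in>\<rat>. s q = q"
      using s by (auto simp: carr)
    have inj: "inj_on s K" and sur: "s ` K = K"
      using sB by (auto simp: Bij_def bij_betw_def)
    have inv: "inv\<^bsub>BijGroup K\<^esub> s = (\<lambda>x\<in>K. inv_into K s x)"
      using sB by (rule inv_BijGroup)
    have iso: "s \<in> ring_iso R R" using sB hom by (auto simp: ring_iso_def Bij_def cR)
    have "inv_into K s \<in> ring_hom R R"
      using ring_iso_set_sym[OF R.ring_axioms iso] by (simp add: ring_iso_def cR)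
    then have "(\<lambda>x\<in>K. inv_into K s x) \<in> ring_hom R R"
      using R.ring_axioms cR R.m_closed R.a_closed R.one_closed by (auto simp: ring_hom_def)
    moreover have "inv_into K s q = q" if "q \<in> \<rat>" for q
      using that rat fixQ inj by (metis inv_into_f_f subsetD)
    ultimately show "inv\<^bsub>BijGroup K\<^esub> s \<in> rat_automorphisms K"
      using rat restrict_inv_into_Bij[OF sB] by (auto simp: inv carr)
  next
    fix s t assume st: "s \<in> rat_automorphisms K" "t \<in> rat_automorphisms K"
    then have B: "s \<in> Bij K" "t \<in> Bij K" by (auto simp: carr)
    have "compose K s t \<in> ring_hom R R"
      using st R.m_closed R.a_closed R.one_closed
      unfolding carr ring_hom_def cR by (auto simp: compose_def Pi_iff)
    then show "s \<otimes>\<^bsub>BijGroup K\<^esub> t \<in> rat_automorphisms K"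
      using st B rat compose_Bij[OF B]
      by (auto simp: carr BijGroup_def compose_eq subset_iff)
  qed
  then show ?thesis
    using B.subgroup_imp_group unfolding galois_group_def K_def by blast
qed

end

theory Submission
  imports Defs "HOL-Algebra.Group_Action"
begin

text \<open>
  If \<open>f(n)\<close> is divisible by \<open>p\<^sup>2\<close> and \<open>f'(n)\<close> by \<open>p\<close> for a nonunit \<open>p\<close>, then
  \<open>(f(x) - f(n)) / (p (x - n))\<close> takes at \<open>\<theta>\<close> an integral value outside \<open>\<int>[\<theta>]\<close>.  So monogenicity
  makes \<open>d\<close> squarefree and \<open>\<delta>\<close> free of odd squares prime to \<open>d\<close>, and it rules out
  \<open>4 | a\<close> with \<open>d \<equiv> 3 (mod 4)\<close>.  Under these conditions the resolvent cubic
  \<open>y\<^sup>3 - 4 d y - a\<^sup>2 d\<close> has an integer root only for \<open>(a, d) = (\<plusminus>2, 2)\<close>.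

  If the resolvent has no root, it is irreducible, and the Galois group acts transitively on the four
  roots of \<open>f\<close> and on the three roots of the resolvent, so its order is 12 or 24.  As the
  discriminant of \<open>f\<close> is \<open>d\<^sup>2 \<delta>\<close>, the group is contained in \<open>A\<^sub>4\<close> exactly when \<open>\<delta>\<close> is a square.
  In the two exceptional cases the group preserves a partition of the roots into pairs, and it
  contains a transposition, which leaves only \<open>D\<^sub>4\<close>.
\<close>

section \<open>Integer roots of the resolvent cubic\<close>

lemma squarefree_dvd_powerD:
  fixes n x :: "'a :: {semiring_gcd}"
  assumes "squarefree n" and "n dvd x ^ k"
  shows "n dvd x"
proof -
  define g where "g = gcd n x"
  obtain m where m: "n = g * m" unfolding g_def by (meson dvd_def gcd_dvd1)
  define h where "h = gcd m x"
  have "h dvd g" unfolding g_def h_def using m by (auto intro: gcd_greatest dvd_trans[OF gcd_dvd1])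
  moreover have "h dvd m" by (simp add: h_def)
  ultimately have "h ^ 2 dvd n" unfolding m power2_eq_square by (rule mult_dvd_mono)
  then have "h dvd 1" using assms(1) by (rule squarefreeD[rotated])
  then have "coprime m x" unfolding h_def by (meson is_unit_gcd)
  moreover have "m dvd x ^ k" using assms(2) m by (metis dvd_mult_right)
  ultimately have "m dvd 1"
    by (metis coprime_power_right_iff coprime_absorb_left coprime_imp_coprime dvd_refl)
  then have "n dvd g" unfolding m by (simp add: mult_unit_dvd_iff)
  then show ?thesis unfolding g_def using dvd_trans gcd_dvd2 by blast
qed

text \<open>
  An integer root \<open>y\<close> of the resolvent cubic forces \<open>y = d z\<close>, \<open>a = d b\<close> and
  \<open>\<delta> = d (16 - 3 d z\<^sup>2) (3 d z\<^sup>2 - 4)\<^sup>2\<close>, so \<open>3 d z\<^sup>2 - 4\<close> has no odd divisor other than units.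
\<close>
lemma resolvent_root_imp:
  fixes a d y :: int
  assumes nz: "a \<noteq> 0" "d \<noteq> 0" and sqf: "squarefree d"
    and odd_part: "\<And>q. odd q \<Longrightarrow> coprime q d \<Longrightarrow> q ^ 2 dvd 256 * d - 27 * a ^ 4 \<Longrightarrow> is_unit q"
    and two: "\<not> (4 dvd a \<and> d mod 4 = 3)"
    and root: "y ^ 3 = 4 * d * y + a ^ 2 * d"
  shows "(a, d) = (2, 2) \<or> (a, d) = (-2, 2)"
proof -
  have "d dvd y ^ 3" unfolding root by simp
  then obtain z where z: "y = d * z" using squarefree_dvd_powerD[OF sqf] by blast
  have "d * (d ^ 2 * z ^ 3) = d * (4 * d * z + a ^ 2)"
    using root unfolding z by (simp add: power_mult_distrib algebra_simps power2_eq_square power3_eq_cube)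
  then have e1: "d ^ 2 * z ^ 3 = 4 * d * z + a ^ 2" using nz by simp
  then have "a ^ 2 = d * (d * z ^ 3 - 4 * z)" by (simp add: algebra_simps power2_eq_square)
  then have "d dvd a ^ 2" by simp
  then obtain b where b: "a = d * b" using squarefree_dvd_powerD[OF sqf] by blast
  have "d * (d * z ^ 3) = d * (4 * z + d * b ^ 2)"
    using e1 unfolding b by (simp add: power_mult_distrib algebra_simps power2_eq_square)
  then have e2: "d * z ^ 3 = 4 * z + d * b ^ 2" using nz by simp
  define N where "N = 3 * (d * z ^ 2) - 4"
  have b0: "b \<noteq> 0" using nz b by simp
  have zn: "z \<noteq> 0" using e2 b0 nz by auto
  have delta: "256 * d - 27 * a ^ 4 = d * (16 - 3 * (d * z ^ 2)) * N ^ 2"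
  proof -
    have "a ^ 4 = d * (d * (d * b ^ 2) ^ 2)" unfolding b by (simp add: power_mult_distrib power2_eq_square power4_eq_xxxx)
    also have "d * b ^ 2 = d * z ^ 3 - 4 * z" using e2 by simp
    finally show ?thesis unfolding N_def by (simp add: algebra_simps power2_eq_square power3_eq_cube)
  qed
  have unit: "is_unit q" if q: "odd q" "q dvd N" for q
  proof (rule odd_part)
    show "odd q" by fact
    show "coprime q d"
    proof (rule coprimeI)
      fix c assume c: "c dvd q" "c dvd d"
      then have "c dvd N" using q dvd_trans by blast
      moreover have "c dvd 3 * (d * z ^ 2)" using c by simp
      ultimately have "c dvd 3 * (d * z ^ 2) - N" by (rule dvd_diff[rotated])
      then have "c dvd 2 ^ 2" by (simp add: N_def)
      moreover have "coprime c (2 ^ 2)"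
        using q(1) c(1) by (metis coprime_power_right_iff coprime_right_2_iff_odd dvd_trans)
      ultimately show "is_unit c"
        by (metis coprime_absorb_left)
    qed
    show "q ^ 2 dvd 256 * d - 27 * a ^ 4"
      unfolding delta using q(2) by (simp add: dvd_power_same)
  qed
  have unit': "x = 1 \<or> x = -1" if "odd x" "x dvd N" for x
    using unit[OF that] by auto
  show ?thesis
  proof (cases "even d")
    case False
    have "d dvd z * 4" using e2 by (metis dvd_add_left_iff dvd_triv_left mult.commute)
    moreover have "coprime d (2 ^ 2)" using False by (metis coprime_power_right_iff coprime_right_2_iff_odd)
    ultimately obtain w where w: "z = d * w"
      by (metis coprime_dvd_mult_left_iff dvd_def numeral_Bit0_eq_double power2_eq_square)
    have "d * (w * (d ^ 3 * w ^ 2 - 4)) = d * b ^ 2"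
      using e2 unfolding w by (simp add: algebra_simps power2_eq_square power3_eq_cube)
    then have e3: "b ^ 2 = w * (d ^ 3 * w ^ 2 - 4)" using nz by simp
    have N: "N = 3 * (d ^ 3 * w ^ 2) - 4"
      unfolding N_def w by (simp add: algebra_simps power2_eq_square power3_eq_cube)
    show ?thesis
    proof (cases "even w")
      case w_odd: False
      then have "odd N" unfolding N using False by simp
      then have "N = 1 \<or> N = -1" using unit'[of N] by simp
      then have D: "d ^ 3 * w ^ 2 = 1" unfolding N by auto
      then have "w dvd 1" by (metis dvd_mult dvd_refl dvd_power pos2)
      then have "w = 1 \<or> w = -1" by auto
      moreover have "b ^ 2 = w * (-3)" using e3 D by simp
      moreover have "b ^ 2 \<ge> 0" by simp
      ultimately have "b ^ 2 = 3" by auto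
      have "\<bar>b\<bar> < 2" using \<open>b ^ 2 = 3\<close> power_mono[of 2 "\<bar>b\<bar>" 2] by (simp add: not_le[symmetric]) blast
      then have "b = -1 \<or> b = 0 \<or> b = 1" by linarith
      then have False using \<open>b ^ 2 = 3\<close> by auto
      then show ?thesis ..
    next
      case True
      then obtain v where v: "w = 2 * v" by blast
      define D where "D = d ^ 3 * v ^ 2"
      have N2: "N = 4 * (3 * D - 1)" unfolding N v D_def by (simp add: power_mult_distrib algebra_simps)
      have bD: "b ^ 2 = 8 * v * (D - 1)" using e3 unfolding v D_def by (simp add: power_mult_distrib algebra_simps)
      have D0: "D \<noteq> 0" using zn nz unfolding D_def w v by auto
      have "even b" using bD by (metis even_mult_iff even_numeral even_power)
      then obtain b1 where b1: "b = 2 * b1" by blast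
      then have b1D: "b1 ^ 2 = 2 * (v * (D - 1))" using bD by (simp add: power_mult_distrib)
      then have "even b1" by (metis dvd_triv_left even_power)
      then have "4 dvd a" unfolding b b1 by auto
      then have d4: "d mod 4 = 1" using two False by presburger
      show ?thesis
      proof (cases "even v")
        case True
        then have "odd (3 * D - 1)" unfolding D_def by simp
        then have "3 * D - 1 = 1 \<or> 3 * D - 1 = -1" using unit'[of "3 * D - 1"] N2 by (metis dvd_triv_right)
        then have False using D0 by presburger
        then show ?thesis ..
      next
        case v_odd: False
        obtain k where k: "d = 1 + 4 * k" using d4 by (metis mult_div_mod_eq add.commute)
        obtain l where l: "v = 2 * l + 1" using v_odd oddE by blast
        have "\<exists>j. D = 1 + 4 * j"
        proof -
          have "D = 1 + 4 * ((3 * k + 12 * k ^ 2 + 16 * k ^ 3) * v ^ 2 + l ^ 2 + l)"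
            unfolding D_def k l by (simp add: algebra_simps power2_eq_square power3_eq_cube)
          then show ?thesis by blast
        qed
        then obtain j where j: "D = 1 + 4 * j" ..
        have "3 * D - 1 = 2 * (6 * j + 1)" by (simp add: j)
        then have "N = (6 * j + 1) * 8" unfolding N2 by simp
        then have "6 * j + 1 dvd N" by (rule dvdI)
        then have "6 * j + 1 = 1 \<or> 6 * j + 1 = -1" using unit'[of "6 * j + 1"] by (metis dvd_triv_left even_add even_mult_iff even_numeral odd_one)
        then have "j = 0" by presburger
        then have "b1 ^ 2 = 0" using b1D j by simp
        then have False using b0 b1 by simp
        then show ?thesis ..
      qed
    qed
  next
    case True
    then obtain m where m: "d = 2 * m" by blast
    have m_odd: "odd m"
    proof
      assume "even m"
      then have "2 ^ 2 dvd d" unfolding m by auto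
      then show False using squarefreeD[OF sqf, of 2] by simp
    qed
    have e2m: "m * z ^ 3 = 2 * z + m * b ^ 2" using e2 unfolding m by simp
    have "m dvd z * 2" using e2m by (metis dvd_add_left_iff dvd_triv_left mult.commute)
    moreover have "coprime m 2" using m_odd by simp
    ultimately obtain w where w: "z = m * w" by (metis coprime_dvd_mult_left_iff dvd_def)
    have "m * (w * (m ^ 3 * w ^ 2 - 2)) = m * b ^ 2"
      using e2m unfolding w by (simp add: algebra_simps power2_eq_square power3_eq_cube)
    then have e3: "b ^ 2 = w * (m ^ 3 * w ^ 2 - 2)" using nz m by simp
    define D where "D = m ^ 3 * w ^ 2"
    have N: "N = 2 * (3 * D - 2)"
      unfolding N_def w m D_def by (simp add: algebra_simps power2_eq_square power3_eq_cube)
    have D0: "D \<noteq> 0" using zn nz unfolding D_def w m by auto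
    show ?thesis
    proof (cases "even w")
      case w_odd: False
      then have "odd (3 * D - 2)" unfolding D_def using m_odd by simp
      then have "3 * D - 2 = 1 \<or> 3 * D - 2 = -1" using unit'[of "3 * D - 2"] N by (metis dvd_triv_right)
      then have D1: "D = 1" by presburger
      then have "w dvd 1" unfolding D_def by (metis dvd_mult dvd_refl dvd_power pos2)
      then have w1: "w = 1 \<or> w = -1" by auto
      then have m3: "m ^ 3 = 1" using D1 unfolding D_def by auto
      then have "m dvd 1" by (metis dvd_power dvd_refl zero_less_numeral)
      then have "m = 1 \<or> m = -1" by auto
      then have "m = 1" using m3 by auto
      moreover have "b ^ 2 = - w" using e3 D1 unfolding D_def by simp
      moreover have "b ^ 2 \<ge> 0" by simp
      ultimately have "b ^ 2 = 1" using w1 by auto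
      then have "b = 1 \<or> b = -1" by (simp add: power2_eq_1_iff)
      then show ?thesis using \<open>m = 1\<close> b m by auto
    next
      case True
      then obtain t where t: "w = 2 * t" by blast
      define E where "E = m ^ 3 * t ^ 2"
      have DE: "D = 4 * E" unfolding D_def t E_def by (simp add: power_mult_distrib)
      have "N = 4 * (6 * E - 1)" unfolding N DE by simp
      then have "6 * E - 1 dvd N" by (metis dvd_triv_right)
      then have "6 * E - 1 = 1 \<or> 6 * E - 1 = -1" using unit'[of "6 * E - 1"] by fastforce
      then have "E = 0" by presburger
      then have False using D0 DE by simp
      then show ?thesis ..
    qed
  qed
qed

section \<open>Embeddings of subfields of the complex numbers\<close>

locale complex_subfield =
  fixes F :: "complex set"
  assumes one_closed: "1 \<in> F"
    and add_closed: "x \<in> F \<Longrightarrow> y \<in> F \<Longrightarrow> x + y \<in> F"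
    and mult_closed: "x \<in> F \<Longrightarrow> y \<in> F \<Longrightarrow> x * y \<in> F"
    and uminus_closed: "x \<in> F \<Longrightarrow> - x \<in> F"
    and inverse_closed: "x \<in> F \<Longrightarrow> inverse x \<in> F"
begin

lemma zero_closed: "0 \<in> F"
  using add_closed[OF one_closed uminus_closed[OF one_closed]] by simp

lemma diff_closed: "x \<in> F \<Longrightarrow> y \<in> F \<Longrightarrow> x - y \<in> F"
  using add_closed[of x "- y"] uminus_closed by simp

lemma divide_closed: "x \<in> F \<Longrightarrow> y \<in> F \<Longrightarrow> x / y \<in> F"
  by (simp add: divide_inverse mult_closed inverse_closed)

lemma power_closed: "x \<in> F \<Longrightarrow> x ^ n \<in> F"
  by (induction n) (auto intro: one_closed mult_closed)

lemma sum_closed: "(\<And>i. i \<in> I \<Longrightarrow> g i \<in> F) \<Longrightarrow> sum g I \<in> F"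
  by (induction I rule: infinite_finite_induct) (auto intro: zero_closed add_closed)

lemma of_nat_closed: "of_nat n \<in> F"
  by (induction n) (auto intro: zero_closed one_closed add_closed)

lemma of_int_closed: "of_int k \<in> F"
  by (cases k) (auto intro: of_nat_closed uminus_closed simp del: of_nat_Suc)

lemma Rats_closed: "\<rat> \<subseteq> F"
  by (auto elim!: Rats_cases' intro: divide_closed of_int_closed)

lemmas closed_intros = zero_closed one_closed add_closed mult_closed uminus_closed
  diff_closed divide_closed power_closed of_int_closed

definition polys :: "complex poly set"
  where "polys = {p. \<forall>i. Polynomial.coeff p i \<in> F}"

lemma coeff_closed: "p \<in> polys \<Longrightarrow> Polynomial.coeff p i \<in> F"
  by (simp add: polys_def)

lemma polys_closed:
  shows "0 \<in> polys" "1 \<in> polys"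
    and "p \<in> polys \<Longrightarrow> q \<in> polys \<Longrightarrow> p + q \<in> polys"
    and "p \<in> polys \<Longrightarrow> q \<in> polys \<Longrightarrow> p - q \<in> polys"
    and "p \<in> polys \<Longrightarrow> - p \<in> polys"
    and "p \<in> polys \<Longrightarrow> q \<in> polys \<Longrightarrow> p * q \<in> polys"
    and "c \<in> F \<Longrightarrow> Polynomial.monom c n \<in> polys"
    and "c \<in> F \<Longrightarrow> p \<in> polys \<Longrightarrow> pCons c p \<in> polys"
  by (auto simp: polys_def coeff_mult coeff_pCons split: nat.splits
      intro: closed_intros sum_closed)

lemma polys_division:
  assumes "p \<in> polys" "m \<in> polys" "m \<noteq> 0"
  shows "\<exists>s\<in>polys. \<exists>r\<in>polys. p = m * s + r \<and> (r = 0 \<or> Polynomial.degree r < Polynomial.degree m)"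
  using assms(1)
proof (induction "Polynomial.degree p" arbitrary: p rule: less_induct)
  case less
  show ?case
  proof (cases "p = 0 \<or> Polynomial.degree p < Polynomial.degree m")
    case True
    then show ?thesis using less.prems polys_closed(1)
      by (intro bexI[of _ 0] bexI[of _ p]) auto
  next
    case False
    define c where "c = Polynomial.lead_coeff p / Polynomial.lead_coeff m"
    define t where "t = Polynomial.monom c (Polynomial.degree p - Polynomial.degree m)"
    define p' where "p' = p - m * t"
    have c: "c \<in> F" unfolding c_def using less.prems assms(2) by (auto intro: divide_closed coeff_closed)
    then have t: "t \<in> polys" unfolding t_def by (rule polys_closed)
    then have p': "p' \<in> polys" unfolding p'_def using less.prems assms(2) by (auto intro: polys_closed)
    have c0: "c \<noteq> 0" using False assms(3) by (simp add: c_def)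
    then have t0: "t \<noteq> 0" by (simp add: t_def)
    have deg_mt: "Polynomial.degree (m * t) = Polynomial.degree p"
      using False assms(3) t0 c0 by (simp add: degree_mult_eq) (simp add: t_def degree_monom_eq)
    have "Polynomial.coeff (m * t) (Polynomial.degree (m * t)) = Polynomial.lead_coeff m * Polynomial.lead_coeff t"
      by (rule lead_coeff_mult)
    also have "Polynomial.lead_coeff t = c" using c0 by (simp add: t_def degree_monom_eq)
    also have "Polynomial.lead_coeff m * c = Polynomial.lead_coeff p" using assms(3) by (simp add: c_def)
    finally have "Polynomial.coeff p' (Polynomial.degree p) = 0" by (simp add: p'_def deg_mt)
    moreover have "Polynomial.degree p' \<le> Polynomial.degree p"
      unfolding p'_def using deg_mt by (intro degree_diff_le) auto
    ultimately have "p' = 0 \<or> Polynomial.degree p' < Polynomial.degree p"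
      by (metis eq_zero_or_degree_less)
    then have "\<exists>s\<in>polys. \<exists>r\<in>polys. p' = m * s + r \<and> (r = 0 \<or> Polynomial.degree r < Polynomial.degree m)"
    proof
      assume "p' = 0"
      then show ?thesis by (intro bexI[of _ 0]) (auto intro: polys_closed)
    qed (use less.hyps p' in blast)
    then obtain s r where sr: "s \<in> polys" "r \<in> polys" "p' = m * s + r"
      "r = 0 \<or> Polynomial.degree r < Polynomial.degree m" by blast
    show ?thesis
    proof (intro bexI conjI)
      show "p = m * (s + t) + r" using sr(3) by (simp add: p'_def algebra_simps)
    qed (use sr t in \<open>auto intro: polys_closed\<close>)
  qed
qed

end

lemma complex_subfield_Rats: "complex_subfield \<rat>"
  by unfold_locales auto

text \<open>Outside the field, \<open>\<sigma>\<close> is arbitrary.\<close>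
locale complex_embedding = complex_subfield +
  fixes \<sigma> :: "complex \<Rightarrow> complex"
  assumes hom_one: "\<sigma> 1 = 1"
    and hom_add: "x \<in> F \<Longrightarrow> y \<in> F \<Longrightarrow> \<sigma> (x + y) = \<sigma> x + \<sigma> y"
    and hom_mult: "x \<in> F \<Longrightarrow> y \<in> F \<Longrightarrow> \<sigma> (x * y) = \<sigma> x * \<sigma> y"
begin

lemma hom_zero: "\<sigma> 0 = 0"
  using hom_add[OF zero_closed zero_closed] by simp

lemma hom_uminus: "x \<in> F \<Longrightarrow> \<sigma> (- x) = - \<sigma> x"
  using hom_add[of x "- x"] uminus_closed hom_zero by (simp add: eq_neg_iff_add_eq_0 add.commute)

lemma hom_diff: "x \<in> F \<Longrightarrow> y \<in> F \<Longrightarrow> \<sigma> (x - y) = \<sigma> x - \<sigma> y"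
  using hom_add[of x "- y"] uminus_closed hom_uminus by simp

lemma hom_inverse: "x \<in> F \<Longrightarrow> \<sigma> (inverse x) = inverse (\<sigma> x)"
  using hom_mult[of x "inverse x"] inverse_closed hom_one hom_zero
  by (cases "x = 0") (auto simp: inverse_unique)

lemma hom_power: "x \<in> F \<Longrightarrow> \<sigma> (x ^ n) = \<sigma> x ^ n"
  by (induction n) (auto simp: hom_one hom_mult power_closed)

lemma hom_eq_zero_iff: "x \<in> F \<Longrightarrow> \<sigma> x = 0 \<longleftrightarrow> x = 0"
  using hom_mult[of x "inverse x"] inverse_closed[of x] hom_one hom_zero by (cases "x = 0") auto

lemma inj_on_hom: "inj_on \<sigma> F"
  by (rule inj_onI) (metis hom_diff hom_eq_zero_iff diff_closed right_minus_eq)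

lemma hom_sum: "(\<And>i. i \<in> I \<Longrightarrow> g i \<in> F) \<Longrightarrow> \<sigma> (sum g I) = (\<Sum>i\<in>I. \<sigma> (g i))"
  by (induction I rule: infinite_finite_induct) (auto simp: hom_zero hom_add sum_closed)

lemma hom_of_nat: "\<sigma> (of_nat n) = of_nat n"
  by (induction n) (auto simp: hom_zero hom_one hom_add one_closed of_nat_closed)

lemma hom_of_int: "\<sigma> (of_int k) = of_int k"
  by (cases k) (auto simp: hom_of_nat hom_uminus of_nat_closed simp del: of_nat_Suc)

lemma hom_Rats: "q \<in> \<rat> \<Longrightarrow> \<sigma> q = q"
  by (auto elim!: Rats_cases' simp: divide_inverse hom_mult hom_inverse hom_of_int of_int_closed inverse_closed)

lemma map_poly_hom:
  shows "p \<in> polys \<Longrightarrow> q \<in> polys \<Longrightarrow> map_poly \<sigma> (p + q) = map_poly \<sigma> p + map_poly \<sigma> q"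
    and "p \<in> polys \<Longrightarrow> q \<in> polys \<Longrightarrow> map_poly \<sigma> (p - q) = map_poly \<sigma> p - map_poly \<sigma> q"
    and "p \<in> polys \<Longrightarrow> q \<in> polys \<Longrightarrow> map_poly \<sigma> (p * q) = map_poly \<sigma> p * map_poly \<sigma> q"
  by (auto intro!: poly_eqI sum.cong
      simp: coeff_map_poly hom_zero hom_add hom_diff coeff_closed coeff_mult hom_sum hom_mult mult_closed)

lemma degree_map_poly_hom: "p \<in> polys \<Longrightarrow> Polynomial.degree (map_poly \<sigma> p) = Polynomial.degree p"
  by (cases "p = 0") (auto intro!: map_poly_degree_eq simp: hom_eq_zero_iff coeff_closed)

lemma hom_poly:
  assumes "p \<in> polys" "x \<in> F"
  shows "\<sigma> (poly p x) = poly (map_poly \<sigma> p) (\<sigma> x)"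
  using assms
  by (simp add: poly_altdef degree_map_poly_hom coeff_map_poly hom_zero hom_sum hom_mult hom_power
      mult_closed power_closed coeff_closed)

lemma extension_onto:
  assumes alg: "q \<in> polys" "q \<noteq> 0" "poly q \<alpha> = 0"
    and rel: "\<And>p. p \<in> polys \<Longrightarrow> poly p \<alpha> = 0 \<Longrightarrow> poly (map_poly \<sigma> p) \<beta> = 0"
  shows "\<exists>F' \<tau>. complex_embedding F' \<tau> \<and> F \<subseteq> F' \<and> \<alpha> \<in> F' \<and> \<tau> \<alpha> = \<beta> \<and> (\<forall>x\<in>F. \<tau> x = \<sigma> x)"
proof -
  obtain m where m: "m \<in> polys" "m \<noteq> 0" "poly m \<alpha> = 0"
    and min: "\<And>p. p \<in> polys \<Longrightarrow> p \<noteq> 0 \<Longrightarrow> poly p \<alpha> = 0 \<Longrightarrow> Polynomial.degree m \<le> Polynomial.degree p"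
    using exists_least_iff[of "\<lambda>n. \<exists>p\<in>polys. p \<noteq> 0 \<and> poly p \<alpha> = 0 \<and> Polynomial.degree p = n"] alg
    by (metis not_less)
  define F' where "F' = (\<lambda>p. poly p \<alpha>) ` polys"
  define \<tau> where "\<tau> x = poly (map_poly \<sigma> (SOME p. p \<in> polys \<and> poly p \<alpha> = x)) \<beta>" for x
  have \<tau>: "\<tau> (poly p \<alpha>) = poly (map_poly \<sigma> p) \<beta>" if p: "p \<in> polys" for p
  proof -
    define p' where "p' = (SOME p'. p' \<in> polys \<and> poly p' \<alpha> = poly p \<alpha>)"
    have p': "p' \<in> polys \<and> poly p' \<alpha> = poly p \<alpha>"
      unfolding p'_def by (rule someI[of _ p]) (use p in simp)
    then have "poly (map_poly \<sigma> (p' - p)) \<beta> = 0" by (intro rel) (auto intro: polys_closed p)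
    then show ?thesis using p p' by (simp add: \<tau>_def map_poly_hom flip: p'_def)
  qed
  have inv: "\<exists>s\<in>polys. poly p \<alpha> * poly s \<alpha> = 1"
    if "p \<in> polys" "p \<noteq> 0" "Polynomial.degree p < Polynomial.degree m" for p
    using that
  proof (induction "Polynomial.degree p" arbitrary: p rule: less_induct)
    case less
    show ?case
    proof (cases "Polynomial.degree p = 0")
      case True
      then obtain c where c: "p = [:c:]" by (meson degree_eq_zeroE)
      then have "c \<in> F" "c \<noteq> 0" using less.prems coeff_closed[of p 0] by auto
      then show ?thesis unfolding c
        by (intro bexI[of _ "[:inverse c:]"]) (auto intro!: polys_closed inverse_closed)
    next
      case False
      obtain s r where sr: "s \<in> polys" "r \<in> polys" "m = p * s + r" "r = 0 \<or> Polynomial.degree r < Polynomial.degree p"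
        using polys_division[OF m(1) less.prems(1,2)] by blast
      have s0: "s \<noteq> 0" using sr less.prems m by auto
      have p\<alpha>: "poly p \<alpha> \<noteq> 0" using min[OF less.prems(1,2)] less.prems(3) by auto
      have "r \<noteq> 0"
      proof
        assume r: "r = 0"
        then have "poly s \<alpha> = 0" using m(3) p\<alpha> unfolding sr(3) by simp
        then have "Polynomial.degree m \<le> Polynomial.degree s" using min sr s0 by blast
        moreover have "Polynomial.degree m = Polynomial.degree p + Polynomial.degree s"
          unfolding sr(3) using r s0 less.prems by (simp add: degree_mult_eq)
        ultimately show False using False by simp
      qed
      then obtain u where u: "u \<in> polys" "poly r \<alpha> * poly u \<alpha> = 1"
        using less.hyps sr(2,4) less.prems(3) by (metis less_trans)
      have "poly r \<alpha> = - (poly p \<alpha> * poly s \<alpha>)"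
        using m(3) unfolding sr(3) by (simp add: eq_neg_iff_add_eq_0 add.commute)
      then show ?thesis using u sr(1)
        by (intro bexI[of _ "- (s * u)"]) (auto intro: polys_closed simp: mult.assoc)
    qed
  qed
  have "complex_embedding F' \<tau>"
  proof unfold_locales
    show "1 \<in> F'" unfolding F'_def by (rule image_eqI[of _ _ 1]) (auto intro: polys_closed)
    show "x + y \<in> F'" if "x \<in> F'" "y \<in> F'" for x y
    proof -
      obtain p q where "p \<in> polys" "x = poly p \<alpha>" "q \<in> polys" "y = poly q \<alpha>"
        using \<open>x \<in> F'\<close> \<open>y \<in> F'\<close> unfolding F'_def by blast
      then show ?thesis unfolding F'_def by (intro image_eqI[of _ _ "p + q"]) (auto intro: polys_closed)
    qed
    show "x * y \<in> F'" if "x \<in> F'" "y \<in> F'" for x y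
    proof -
      obtain p q where "p \<in> polys" "x = poly p \<alpha>" "q \<in> polys" "y = poly q \<alpha>"
        using \<open>x \<in> F'\<close> \<open>y \<in> F'\<close> unfolding F'_def by blast
      then show ?thesis unfolding F'_def by (intro image_eqI[of _ _ "p * q"]) (auto intro: polys_closed)
    qed
    show "- x \<in> F'" if "x \<in> F'" for x
    proof -
      obtain p where "p \<in> polys" "x = poly p \<alpha>" using \<open>x \<in> F'\<close> unfolding F'_def by blast
      then show ?thesis unfolding F'_def by (intro image_eqI[of _ _ "- p"]) (auto intro: polys_closed)
    qed
    show "inverse x \<in> F'" if "x \<in> F'" for x
    proof -
      obtain p where p: "p \<in> polys" "x = poly p \<alpha>" using \<open>x \<in> F'\<close> unfolding F'_def by blast
      obtain s r where sr: "s \<in> polys" "r \<in> polys" "p = m * s + r" "r = 0 \<or> Polynomial.degree r < Polynomial.degree m"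
        using polys_division[OF p(1) m(1,2)] by blast
      have x: "x = poly r \<alpha>" using p(2) m(3) unfolding sr(3) by simp
      show ?thesis
      proof (cases "r = 0")
        case True
        then show ?thesis using x that by simp
      next
        case False
        then obtain u where "u \<in> polys" "x * poly u \<alpha> = 1" using inv sr(2,4) x by blast
        then show ?thesis unfolding F'_def by (metis image_eqI inverse_unique)
      qed
    qed
    show "\<tau> 1 = 1" using \<tau>[OF polys_closed(2)] by (simp add: hom_one)
    show "\<tau> (x + y) = \<tau> x + \<tau> y" if "x \<in> F'" "y \<in> F'" for x y
    proof -
      obtain p q where "p \<in> polys" "x = poly p \<alpha>" "q \<in> polys" "y = poly q \<alpha>"
        using \<open>x \<in> F'\<close> \<open>y \<in> F'\<close> unfolding F'_def by blast
      then show ?thesis using \<tau>[of "p + q"] by (simp add: \<tau> polys_closed map_poly_hom)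
    qed
    show "\<tau> (x * y) = \<tau> x * \<tau> y" if "x \<in> F'" "y \<in> F'" for x y
    proof -
      obtain p q where "p \<in> polys" "x = poly p \<alpha>" "q \<in> polys" "y = poly q \<alpha>"
        using \<open>x \<in> F'\<close> \<open>y \<in> F'\<close> unfolding F'_def by blast
      then show ?thesis using \<tau>[of "p * q"] by (simp add: \<tau> polys_closed map_poly_hom)
    qed
  qed
  moreover have "x \<in> F' \<and> \<tau> x = \<sigma> x" if "x \<in> F" for x
  proof -
    have "[:x:] \<in> polys" using that by (intro polys_closed)
    from \<tau>[OF this] this show ?thesis
      unfolding F'_def by (auto simp: map_poly_pCons hom_zero intro: image_eqI[of _ _ "[:x:]"])
  qed
  moreover have "\<alpha> \<in> F' \<and> \<tau> \<alpha> = \<beta>"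
  proof -
    have "[:0, 1:] \<in> polys" by (intro polys_closed closed_intros)
    from \<tau>[OF this] this show ?thesis
      unfolding F'_def by (auto simp: map_poly_pCons hom_zero hom_one intro: image_eqI[of _ _ "[:0, 1:]"])
  qed
  ultimately show ?thesis by blast
qed

lemma extension:
  assumes alg: "q \<in> polys" "q \<noteq> 0" "poly q \<alpha> = 0"
  shows "\<exists>F' \<tau>. complex_embedding F' \<tau> \<and> F \<subseteq> F' \<and> \<alpha> \<in> F' \<and> (\<forall>x\<in>F. \<tau> x = \<sigma> x)"
proof -
  obtain m where m: "m \<in> polys" "m \<noteq> 0" "poly m \<alpha> = 0"
    and min: "\<And>p. p \<in> polys \<Longrightarrow> p \<noteq> 0 \<Longrightarrow> poly p \<alpha> = 0 \<Longrightarrow> Polynomial.degree m \<le> Polynomial.degree p"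
    using exists_least_iff[of "\<lambda>n. \<exists>p\<in>polys. p \<noteq> 0 \<and> poly p \<alpha> = 0 \<and> Polynomial.degree p = n"] alg
    by (metis not_less)
  have "Polynomial.degree m \<noteq> 0"
  proof
    assume "Polynomial.degree m = 0"
    then obtain c where "m = [:c:]" by (meson degree_eq_zeroE)
    then show False using m(2,3) by simp
  qed
  then obtain \<beta> where \<beta>: "poly (map_poly \<sigma> m) \<beta> = 0"
    using alg_closed_imp_poly_has_root[of "map_poly \<sigma> m"] degree_map_poly_hom[OF m(1)] by auto
  have "poly (map_poly \<sigma> p) \<beta> = 0" if p: "p \<in> polys" "poly p \<alpha> = 0" for p
  proof -
    obtain s r where sr: "s \<in> polys" "r \<in> polys" "p = m * s + r" "r = 0 \<or> Polynomial.degree r < Polynomial.degree m"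
      using polys_division[OF p(1) m(1,2)] by blast
    have "poly r \<alpha> = 0" using p(2) m(3) unfolding sr(3) by simp
    then have "r = 0" using sr(2,4) min by (meson not_less)
    then show ?thesis unfolding sr(3) using \<beta> m sr(1) by (simp add: map_poly_hom)
  qed
  from extension_onto[OF alg this] show ?thesis by blast
qed

end

lemma complex_embedding_extension:
  assumes "finite A" and "complex_embedding F \<sigma>"
    and "\<And>\<alpha>. \<alpha> \<in> A \<Longrightarrow> \<exists>q. q \<noteq> 0 \<and> (\<forall>i. Polynomial.coeff q i \<in> \<rat>) \<and> poly q \<alpha> = 0"
  shows "\<exists>F' \<tau>. complex_embedding F' \<tau> \<and> F \<subseteq> F' \<and> A \<subseteq> F' \<and> (\<forall>x\<in>F. \<tau> x = \<sigma> x)"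
  using assms
proof (induction A rule: finite_induct)
  case empty
  then show ?case by blast
next
  case (insert \<alpha> A)
  then obtain F1 \<tau>1 where 1: "complex_embedding F1 \<tau>1" "F \<subseteq> F1" "A \<subseteq> F1" "\<forall>x\<in>F. \<tau>1 x = \<sigma> x"
    by blast
  interpret e: complex_embedding F1 \<tau>1 by fact
  obtain q where q: "q \<noteq> 0" "\<forall>i. Polynomial.coeff q i \<in> \<rat>" "poly q \<alpha> = 0"
    using insert.prems by blast
  then have "q \<in> e.polys" using e.Rats_closed by (auto simp: e.polys_def)
  from e.extension[OF this q(1,3)] obtain F' \<tau>
    where 2: "complex_embedding F' \<tau>" "F1 \<subseteq> F'" "\<alpha> \<in> F'" "\<forall>x\<in>F1. \<tau> x = \<tau>1 x"
    by blast
  with 1 have "complex_embedding F' \<tau>" "F \<subseteq> F'" "insert \<alpha> A \<subseteq> F'" "\<forall>x\<in>F. \<tau> x = \<sigma> x"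
    by auto
  then show ?case by blast
qed

lemma complex_ring_simps:
  "carrier complex_ring = UNIV" "\<one>\<^bsub>complex_ring\<^esub> = 1" "\<zero>\<^bsub>complex_ring\<^esub> = 0"
  "x \<oplus>\<^bsub>complex_ring\<^esub> y = x + y" "x \<otimes>\<^bsub>complex_ring\<^esub> y = x * y"
  by (simp_all add: ring_of_type_algebra_def)

lemma complex_ring_a_inv: "\<ominus>\<^bsub>complex_ring\<^esub> x = - x"
proof -
  interpret C: field complex_ring by (rule field_from_type_algebra)
  show ?thesis by (rule C.minus_equality) (simp_all add: complex_ring_simps)
qed

lemma complex_ring_m_inv: "x \<noteq> 0 \<Longrightarrow> inv\<^bsub>complex_ring\<^esub> x = inverse x"
proof -
  interpret C: field complex_ring by (rule field_from_type_algebra)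
  show "x \<noteq> 0 \<Longrightarrow> ?thesis" by (rule C.comm_inv_char) (simp_all add: complex_ring_simps)
qed

lemma complex_subfield_rat_adjoin: "complex_subfield (rat_adjoin S)"
proof
  let ?G = "generate_field complex_ring (\<rat> \<union> S)"
  show "1 \<in> rat_adjoin S"
    using generate_field.one[of complex_ring "\<rat> \<union> S"] by (simp add: rat_adjoin_def complex_ring_simps)
  show "x + y \<in> rat_adjoin S" "x * y \<in> rat_adjoin S" if "x \<in> rat_adjoin S" "y \<in> rat_adjoin S" for x y
    using generate_field.eng_add[of x complex_ring "\<rat> \<union> S" y] generate_field.eng_mult[of x complex_ring "\<rat> \<union> S" y]
      that by (simp_all add: rat_adjoin_def complex_ring_simps)
  show "- x \<in> rat_adjoin S" if "x \<in> rat_adjoin S" for x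
    using generate_field.a_inv[of x complex_ring "\<rat> \<union> S"] that
    by (simp add: rat_adjoin_def complex_ring_a_inv)
  show "inverse x \<in> rat_adjoin S" if "x \<in> rat_adjoin S" for x
    using generate_field.m_inv[of x complex_ring "\<rat> \<union> S"] that
    by (cases "x = 0") (simp_all add: rat_adjoin_def complex_ring_m_inv complex_ring_simps)
qed

lemma rat_adjoin_superset: "S \<subseteq> rat_adjoin S"
  unfolding rat_adjoin_def by (auto intro: generate_field.incl)

lemma rat_adjoin_minimal:
  assumes "complex_subfield F" "S \<subseteq> F"
  shows "rat_adjoin S \<subseteq> F"
proof
  interpret complex_subfield F by fact
  fix x assume "x \<in> rat_adjoin S"
  then show "x \<in> F" unfolding rat_adjoin_def
    by (induction rule: generate_field.induct)
      (use assms(2) Rats_closed in \<open>auto simp: complex_ring_simps complex_ring_a_inv complex_ring_m_inv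
         intro: closed_intros inverse_closed\<close>)
qed

lemma irreducible_poly_no_root:
  fixes p :: "'a :: field poly"
  assumes "Factorial_Ring.irreducible p" "Polynomial.degree p \<noteq> 1"
  shows "poly p x \<noteq> 0"
proof
  assume "poly p x = 0"
  then obtain q where q: "p = [:- x, 1:] * q" by (auto simp: poly_eq_0_iff_dvd)
  then have "Polynomial.degree p = 1 + Polynomial.degree q"
    using assms(1) by (subst q, subst degree_mult_eq) auto
  moreover have "is_unit [:- x, 1:] \<or> is_unit q" using assms(1) q irreducibleD by blast
  ultimately show False using assms(2) by (auto simp: is_unit_poly_iff)
qed

abbreviation rat_eval :: "rat poly \<Rightarrow> complex \<Rightarrow> complex"
  where "rat_eval p \<equiv> poly (map_poly of_rat p)"

lemma rat_eval_add: "rat_eval (p + q) x = rat_eval p x + rat_eval q x"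
proof -
  have "map_poly of_rat (p + q) = map_poly of_rat p + (map_poly of_rat q :: complex poly)"
    by (rule poly_eqI) (simp add: coeff_map_poly of_rat_add)
  then show ?thesis by simp
qed

lemma rat_eval_mult: "rat_eval (p * q) x = rat_eval p x * rat_eval q x"
proof -
  have "map_poly of_rat (p * q) = map_poly of_rat p * (map_poly of_rat q :: complex poly)"
    by (rule poly_eqI) (simp add: coeff_map_poly coeff_mult of_rat_sum of_rat_mult)
  then show ?thesis by simp
qed

lemma rat_irreducible_dvd:
  fixes h g :: "rat poly"
  assumes h: "Factorial_Ring.irreducible h" and "rat_eval h x = 0" "rat_eval g x = 0"
  shows "h dvd g"
proof (rule ccontr)
  assume "\<not> h dvd g"
  then have "gcd h g = 1"
    using h by (metis coprime_iff_gcd_eq_1 irreducible_imp_prime_elem prime_elem_imp_coprime)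
  then obtain r s where "r * h + s * g = 1"
    by (metis bezout_coefficients_fst_snd)
  then have "rat_eval (r * h + s * g) x = 1" by simp
  then show False using assms by (simp add: rat_eval_add rat_eval_mult)
qed

lemma rat_irreducible_common_root:
  assumes "Factorial_Ring.irreducible h" "rat_eval h x = 0" "rat_eval h x' = 0" "rat_eval p x = 0"
  shows "rat_eval p x' = 0"
proof -
  obtain r where "p = h * r" using rat_irreducible_dvd assms by (metis dvdE)
  then show ?thesis using assms by (simp add: rat_eval_mult)
qed

lemma map_poly_of_rat_of_int:
  "map_poly of_rat (map_poly rat_of_int f) = (map_poly of_int f :: complex poly)"
  by (rule poly_eqI) (simp add: coeff_map_poly)

lemma splitting_field_embedding_restrict:
  assumes emb: "complex_embedding F \<tau>" and sub: "splitting_field f \<subseteq> F" and nz: "f \<noteq> 0"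
  shows "restrict \<tau> (splitting_field f) \<in> carrier (galois_group f)"
proof -
  define K where "K = splitting_field f"
  define R where "R = complex_roots f"
  have K: "K = rat_adjoin R" by (simp add: K_def R_def splitting_field_def)
  interpret K: complex_subfield K unfolding K by (rule complex_subfield_rat_adjoin)
  interpret \<tau>: complex_embedding F \<tau> by (rule emb)
  have KF: "x \<in> F" if "x \<in> K" for x using that sub K_def by auto
  have RK: "R \<subseteq> K" unfolding K by (rule rat_adjoin_superset)
  have "map_poly of_int f \<noteq> (0 :: complex poly)"
    using nz by (metis coeff_map_poly coeff_0 leading_coeff_0_iff of_int_0 of_int_eq_0_iff)
  then have finR: "finite R" unfolding R_def complex_roots_def by (rule poly_roots_finite)
  have "\<tau> r \<in> R" if "r \<in> R" for r
  proof -
    have p: "map_poly of_int f \<in> \<tau>.polys" by (simp add: \<tau>.polys_def coeff_map_poly \<tau>.of_int_closed)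
    have "map_poly \<tau> (map_poly of_int f) = map_poly of_int f"
      by (rule poly_eqI) (simp add: coeff_map_poly \<tau>.hom_zero \<tau>.hom_of_int)
    then show ?thesis
      using \<tau>.hom_poly[OF p, of r] that RK KF \<tau>.hom_zero by (auto simp: R_def complex_roots_def)
  qed
  then have "\<tau> ` R \<subseteq> R" by blast
  moreover have "inj_on \<tau> R" using \<tau>.inj_on_hom RK KF by (meson inj_on_subset subset_iff)
  ultimately have \<tau>R: "\<tau> ` R = R" using finR by (simp add: endo_inj_surj)
  have "complex_subfield {x \<in> K. \<tau> x \<in> K}"
    by unfold_locales (auto simp: \<tau>.hom_one \<tau>.hom_add \<tau>.hom_mult \<tau>.hom_uminus \<tau>.hom_inverse KF
        intro: K.closed_intros K.inverse_closed)
  moreover have "R \<subseteq> {x \<in> K. \<tau> x \<in> K}" using RK \<tau>R by auto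
  ultimately have "K \<subseteq> {x \<in> K. \<tau> x \<in> K}" using rat_adjoin_minimal K by blast
  then have \<tau>K: "\<tau> x \<in> K" if "x \<in> K" for x using that by blast
  have "complex_subfield (\<tau> ` K)"
  proof
    show "1 \<in> \<tau> ` K" using K.one_closed \<tau>.hom_one by (metis image_eqI)
    show "x + y \<in> \<tau> ` K" if "x \<in> \<tau> ` K" "y \<in> \<tau> ` K" for x y
      using that by (auto simp: KF simp flip: \<tau>.hom_add intro: K.add_closed)
    show "x * y \<in> \<tau> ` K" if "x \<in> \<tau> ` K" "y \<in> \<tau> ` K" for x y
      using that by (auto simp: KF simp flip: \<tau>.hom_mult intro: K.mult_closed)
    show "- x \<in> \<tau> ` K" if "x \<in> \<tau> ` K" for x
      using that by (auto simp: KF simp flip: \<tau>.hom_uminus intro: K.uminus_closed)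
    show "inverse x \<in> \<tau> ` K" if "x \<in> \<tau> ` K" for x
      using that by (auto simp: KF simp flip: \<tau>.hom_inverse intro: K.inverse_closed)
  qed
  moreover have "R \<subseteq> \<tau> ` K" using RK \<tau>R by (metis image_mono)
  ultimately have "K \<subseteq> \<tau> ` K" using rat_adjoin_minimal K by blast
  then have "\<tau> ` K = K" using \<tau>K by blast
  moreover have "inj_on \<tau> K" using \<tau>.inj_on_hom KF by (meson inj_on_subset subset_iff)
  ultimately have "restrict \<tau> K \<in> Bij K" by (simp add: Bij_def bij_betw_def inj_on_def)
  moreover have "restrict \<tau> K \<in> ring_hom (complex_ring\<lparr>carrier := K\<rparr>) (complex_ring\<lparr>carrier := K\<rparr>)"
    by (auto simp: ring_hom_def complex_ring_simps \<tau>K KF \<tau>.hom_add \<tau>.hom_mult \<tau>.hom_one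
        K.add_closed K.mult_closed K.one_closed)
  moreover have "\<forall>q\<in>\<rat>. restrict \<tau> K q = q" using K.Rats_closed \<tau>.hom_Rats by auto
  ultimately show ?thesis by (simp add: galois_group_def rat_automorphisms_def flip: K_def)
qed

lemma galois_group_conjugate:
  assumes nz: "f \<noteq> 0" and x: "x \<in> splitting_field f"
    and h: "Factorial_Ring.irreducible h" "rat_eval h x = 0" "rat_eval h x' = 0"
  shows "\<exists>\<sigma>\<in>carrier (galois_group f). \<sigma> x = x'"
proof -
  interpret Q: complex_subfield \<rat> by (rule complex_subfield_Rats)
  interpret Q: complex_embedding \<rat> "\<lambda>x. x" by unfold_locales auto
  have of_rat_poly: "\<exists>p'. p = map_poly of_rat p'" if "p \<in> Q.polys" for p
  proof -
    define g where "g = (\<lambda>x::complex. SOME q. x = of_rat q)"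
    have g: "of_rat (g x) = x" if "x \<in> \<rat>" for x
      unfolding g_def using that by (metis (mono_tags, lifting) Rats_cases someI)
    then have "g 0 = 0" by (metis Rats_0 of_rat_eq_0_iff)
    then have "p = map_poly of_rat (map_poly g p)"
      using g that by (intro poly_eqI) (simp add: coeff_map_poly Q.polys_def)
    then show ?thesis ..
  qed
  have h0: "h \<noteq> 0" using h(1) by auto
  have "\<exists>F' \<tau>. complex_embedding F' \<tau> \<and> \<rat> \<subseteq> F' \<and> x \<in> F' \<and> \<tau> x = x' \<and> (\<forall>x\<in>\<rat>. \<tau> x = x)"
  proof (rule Q.extension_onto)
    show "map_poly of_rat h \<in> Q.polys" by (simp add: Q.polys_def coeff_map_poly)
    show "map_poly of_rat h \<noteq> (0 :: complex poly)" using h0 by (simp add: map_poly_eq_0_iff)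
    show "rat_eval h x = 0" by fact
    show "poly (map_poly (\<lambda>x. x) p) x' = 0" if "p \<in> Q.polys" "poly p x = 0" for p
      using of_rat_poly[OF that(1)] that(2) rat_irreducible_common_root[OF h] by auto
  qed
  then obtain F \<tau> where F: "complex_embedding F \<tau>" "x \<in> F" "\<tau> x = x'" by blast
  define P where "P = (map_poly of_int f :: complex poly)"
  have P0: "P \<noteq> 0"
    unfolding P_def using nz by (metis coeff_map_poly coeff_0 leading_coeff_0_iff of_int_0 of_int_eq_0_iff)
  have R: "complex_roots f = {z. poly P z = 0}" by (simp add: complex_roots_def P_def)
  have "\<forall>i. Polynomial.coeff P i \<in> \<rat>" by (simp add: P_def coeff_map_poly)
  then have "\<exists>F' \<tau>'. complex_embedding F' \<tau>' \<and> F \<subseteq> F' \<and> complex_roots f \<subseteq> F' \<and> (\<forall>x\<in>F. \<tau>' x = \<tau> x)"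
    using P0 F(1) poly_roots_finite[OF P0] by (intro complex_embedding_extension) (auto simp: R)
  then obtain F' \<tau>' where F': "complex_embedding F' \<tau>'" "F \<subseteq> F'" "complex_roots f \<subseteq> F'" "\<forall>x\<in>F. \<tau>' x = \<tau> x"
    by blast
  then have "splitting_field f \<subseteq> F'"
    unfolding splitting_field_def by (intro rat_adjoin_minimal) (auto simp: complex_embedding_def)
  from splitting_field_embedding_restrict[OF F'(1) this nz] show ?thesis
    using x F(2,3) F'(4) by (intro bexI) auto
qed

text \<open>
  Writing \<open>f(n + t) = t\<^sup>4 + g\<^sub>3 t\<^sup>3 + g\<^sub>2 t\<^sup>2 + g\<^sub>1 t + g\<^sub>0\<close>, the element
  \<open>(\<theta>'\<^sup>3 + g\<^sub>3 \<theta>'\<^sup>2 + g\<^sub>2 \<theta>' + g\<^sub>1) / p\<close> with \<open>\<theta>' = \<theta> - n\<close> is integral but not in \<open>\<int>[\<theta>]\<close>.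
\<close>
lemma monogenic_quartic_dvd:
  fixes a d n p :: int
  assumes mono: "monogenic [:d, 0, 0, a, 1:]"
    and sq: "p ^ 2 dvd n ^ 4 + a * n ^ 3 + d" and dv: "p dvd 4 * n ^ 3 + 3 * a * n ^ 2"
  shows "is_unit p"
proof (rule ccontr)
  assume np: "\<not> is_unit p"
  define f :: "int poly" where "f = [:d, 0, 0, a, 1:]"
  have fQ: "map_poly rat_of_int f = [:of_int d, 0, 0, of_int a, 1:]"
    by (simp add: f_def map_poly_pCons)
  have fC: "map_poly of_int f = [:of_int d, 0, 0, of_int a, 1 :: complex:]"
    by (simp add: f_def map_poly_pCons)
  have irr: "Factorial_Ring.irreducible (map_poly rat_of_int f)"
    using mono by (simp add: monogenic_def f_def)
  obtain \<theta> where "poly [:of_int d, 0, 0, of_int a, 1 :: complex:] \<theta> = 0"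
    using alg_closed_imp_poly_has_root[of "[:of_int d, 0, 0, of_int a, 1 :: complex:]"] by auto
  then have \<theta>: "\<theta> \<in> complex_roots f" by (simp add: complex_roots_def fC)
  define K where "K = rat_adjoin {\<theta>}"
  interpret K: complex_subfield K unfolding K_def by (rule complex_subfield_rat_adjoin)
  have "Polynomial.degree f = 4" by (simp add: f_def)
  then have span: "int_mod.span {\<theta> ^ i | i. i < 4} = ring_of_integers K"
    using mono \<theta> by (auto simp: monogenic_def int_basis_def K_def simp flip: f_def)
  obtain c where c: "n ^ 4 + a * n ^ 3 + d = p ^ 2 * c" using sq by blast
  obtain e where e: "4 * n ^ 3 + 3 * a * n ^ 2 = p * e" using dv by blast
  define g2 where "g2 = 6 * n ^ 2 + 3 * a * n"
  define g3 where "g3 = 4 * n + a"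
  define N P C E A D G2 G3 :: complex
    where NP: "N = of_int n" "P = of_int p" "C = of_int c" "E = of_int e" "A = of_int a" "D = of_int d"
      "G2 = of_int g2" "G3 = of_int g3"
  have cC: "N ^ 4 + A * N ^ 3 + D = P ^ 2 * C" using arg_cong[OF c, of complex_of_int] by (simp add: NP)
  have eC: "4 * N ^ 3 + 3 * A * N ^ 2 = P * E" using arg_cong[OF e, of complex_of_int] by (simp add: NP)
  have G2: "G2 = 6 * N ^ 2 + 3 * A * N" by (simp add: NP g2_def)
  have G3: "G3 = 4 * N + A" by (simp add: NP g3_def)
  have "p \<noteq> 0"
  proof
    assume "p = 0"
    then have "poly (map_poly rat_of_int f) (of_int n) = of_int (n ^ 4 + a * n ^ 3 + d)"
      unfolding fQ by (simp add: algebra_simps power2_eq_square power3_eq_cube power4_eq_xxxx)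
    also have "\<dots> = 0" using c \<open>p = 0\<close> by simp
    finally show False using irreducible_poly_no_root[OF irr] by (simp add: fQ)
  qed
  then have P0: "P \<noteq> 0" by (simp add: NP)
  define t where "t = \<theta> - N"
  define \<alpha> where "\<alpha> = (t ^ 3 + G3 * t ^ 2 + G2 * t + P * E) / P"
  have root: "\<theta> ^ 4 + A * \<theta> ^ 3 + D = 0"
    using \<theta> by (simp add: complex_roots_def fC NP algebra_simps power2_eq_square power3_eq_cube power4_eq_xxxx)
  have P\<alpha>: "P * \<alpha> = t ^ 3 + G3 * t ^ 2 + G2 * t + P * E" using P0
    by (simp only: \<alpha>_def times_divide_eq_right nonzero_mult_div_cancel_left not_False_eq_True)
  have "P * (t * \<alpha>) = t * (t ^ 3 + G3 * t ^ 2 + G2 * t + P * E)"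
    unfolding P\<alpha>[symmetric] by (simp only: mult_ac)
  also have "\<dots> = (\<theta> ^ 4 + A * \<theta> ^ 3 + D) - P ^ 2 * C"
    unfolding G2 G3 eC[symmetric] cC[symmetric] t_def
    by (simp add: algebra_simps power2_eq_square power3_eq_cube power4_eq_xxxx)
  also have "\<dots> = P * (- P * C)" using root by (simp add: power2_eq_square)
  finally have t\<alpha>: "t * \<alpha> = - P * C" using P0 by (simp only: mult_left_cancel not_False_eq_True)
  have "P * (\<alpha> ^ 4 - E * \<alpha> ^ 3 + G2 * C * \<alpha> ^ 2 - G3 * P * C ^ 2 * \<alpha> + P ^ 2 * C ^ 3)
      = \<alpha> ^ 3 * (P * \<alpha>) - P * E * \<alpha> ^ 3 - G2 * (- P * C) * \<alpha> ^ 2 - G3 * (- P * C) ^ 2 * \<alpha> - (- P * C) ^ 3"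
    by (simp add: algebra_simps power2_eq_square power3_eq_cube power4_eq_xxxx)
  also have "\<dots> = 0"
    unfolding t\<alpha>[symmetric] P\<alpha>
    by (simp add: algebra_simps power2_eq_square power3_eq_cube power4_eq_xxxx)
  finally have eq: "\<alpha> ^ 4 - E * \<alpha> ^ 3 + G2 * C * \<alpha> ^ 2 - G3 * P * C ^ 2 * \<alpha> + P ^ 2 * C ^ 3 = 0"
    using P0 by (simp only: mult_eq_0_iff simp_thms)
  have "algebraic_int \<alpha>"
  proof (rule algebraic_int.intros)
    let ?q = "[:P ^ 2 * C ^ 3, - (G3 * P * C ^ 2), G2 * C, - E, 1:]"
    show "Polynomial.lead_coeff ?q = 1" by simp
    show "\<forall>i. Polynomial.coeff ?q i \<in> \<int>"
      by (auto simp: coeff_pCons NP split: nat.splits)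
    show "poly ?q \<alpha> = 0"
      using eq by (simp add: algebra_simps power2_eq_square power3_eq_cube power4_eq_xxxx)
  qed
  moreover have "\<alpha> \<in> K"
  proof -
    have "\<theta> \<in> K" using rat_adjoin_superset K_def by blast
    then show ?thesis unfolding \<alpha>_def t_def NP by (intro K.closed_intros)
  qed
  ultimately have "\<alpha> \<in> int_mod.span {\<theta> ^ i | i. i < 4}" unfolding span by (simp add: ring_of_integers_def)
  then have "\<exists>c0 c1 c2 c3. \<alpha> = of_int c0 + of_int c1 * \<theta> + of_int c2 * \<theta> ^ 2 + of_int c3 * \<theta> ^ 3"
  proof (induction rule: int_mod.span_induct_alt)
    case base
    show ?case by (intro exI[of _ 0]) simp
  next
    case (step k x y)
    then obtain i where i: "i < 4" "x = \<theta> ^ i" by blast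
    from step obtain c0 c1 c2 c3 where y: "y = of_int c0 + of_int c1 * \<theta> + of_int c2 * \<theta> ^ 2 + of_int c3 * \<theta> ^ 3"
      by blast
    have "i = 0 \<or> i = 1 \<or> i = 2 \<or> i = 3" using i(1) by auto
    then have "int_scale k x + y = of_int (c0 + (if i = 0 then k else 0)) + of_int (c1 + (if i = 1 then k else 0)) * \<theta>
        + of_int (c2 + (if i = 2 then k else 0)) * \<theta> ^ 2 + of_int (c3 + (if i = 3 then k else 0)) * \<theta> ^ 3"
      unfolding i(2) y int_scale_def by (elim disjE) (simp_all add: algebra_simps)
    then show ?case by blast
  qed
  then obtain c0 c1 c2 c3 where
    \<alpha>: "\<alpha> = of_int c0 + of_int c1 * \<theta> + of_int c2 * \<theta> ^ 2 + of_int c3 * \<theta> ^ 3" by blast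
  define k where "k = 1 - p * c3"
  define h :: "int poly" where "h = [: p * e - n ^ 3 + g3 * n ^ 2 - g2 * n - p * c0,
    3 * n ^ 2 - 2 * n * g3 + g2 - p * c1, g3 - 3 * n - p * c2, k :]"
  have "rat_eval (map_poly rat_of_int h) \<theta> = P * \<alpha> - P * (of_int c0 + of_int c1 * \<theta> + of_int c2 * \<theta> ^ 2 + of_int c3 * \<theta> ^ 3)"
    unfolding P\<alpha> map_poly_of_rat_of_int h_def t_def
    by (simp add: map_poly_pCons NP k_def algebra_simps power2_eq_square power3_eq_cube)
  also have "\<dots> = 0" using \<alpha> by simp
  finally have dvd: "map_poly rat_of_int f dvd map_poly rat_of_int h"
    using \<theta> by (intro rat_irreducible_dvd[OF irr, of \<theta>]) (simp_all add: map_poly_of_rat_of_int complex_roots_def)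
  have "k \<noteq> 0" unfolding k_def using np by (metis dvd_triv_left eq_iff_diff_eq_0)
  then have "Polynomial.degree (map_poly rat_of_int h) = 3" "map_poly rat_of_int h \<noteq> 0"
    by (simp_all add: h_def map_poly_pCons)
  then show False using dvd_imp_degree_le[OF dvd] by (simp add: fQ)
qed

section \<open>The Galois group of a quartic\<close>

lemma rat_monic_int_root:
  fixes x :: complex
  assumes "Polynomial.lead_coeff p = 1" "poly (map_poly of_int p) x = 0" "x \<in> \<rat>"
  shows "\<exists>k. x = of_int k"
proof -
  have "algebraic_int x" using assms by (auto simp: algebraic_int_altdef_ipoly)
  then have "x \<in> \<int>" using assms(3) by (rule rational_algebraic_int_is_int)
  then show ?thesis by (rule Ints_cases) blast
qed

lemma rat_eval_of_rat: "rat_eval p (of_rat x) = of_rat (poly p x)"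
  by (induction p) (simp_all add: map_poly_pCons of_rat_add of_rat_mult)

lemma poly_of_int_eval: "poly (map_poly of_int p) (of_int k) = (of_int (poly p k) :: 'a :: comm_ring_1)"
  by (induction p) (simp_all add: map_poly_pCons)

lemma irreducible_rat_poly_no_root:
  fixes p :: "int poly"
  assumes "Polynomial.lead_coeff p = 1" "Polynomial.degree p = 2 \<or> Polynomial.degree p = 3"
    and noroot: "\<And>k. poly p k \<noteq> 0"
  shows "Factorial_Ring.irreducible (map_poly rat_of_int p)"
proof -
  have deg: "Polynomial.degree (map_poly rat_of_int p) = Polynomial.degree p"
    by (rule map_poly_degree_eq) (use assms in auto)
  have nz: "map_poly rat_of_int p \<noteq> 0" using deg assms(2) by auto
  have nr: "poly (map_poly rat_of_int p) x \<noteq> 0" for x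
  proof
    assume "poly (map_poly rat_of_int p) x = 0"
    then have "rat_eval (map_poly rat_of_int p) (of_rat x) = 0"
      by (simp add: rat_eval_of_rat)
    then have *: "poly (map_poly of_int p) (of_rat x :: complex) = 0" by (simp add: map_poly_of_rat_of_int)
    then obtain k where "of_rat x = (of_int k :: complex)" using rat_monic_int_root assms(1) Rats_of_rat by blast
    then have "poly (map_poly of_int p) (of_int k :: complex) = 0" using * by simp
    then have "(of_int (poly p k) :: complex) = 0" by (simp only: poly_of_int_eval)
    then show False using noroot by simp
  qed
  show ?thesis
  proof (rule irreducibleI)
    show "map_poly rat_of_int p \<noteq> 0" by (rule nz)
    show "\<not> is_unit (map_poly rat_of_int p)" using deg assms(2) by (auto simp: is_unit_iff_degree nz)
  next
    fix u v assume uv: "map_poly rat_of_int p = u * v"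
    then have uv0: "u \<noteq> 0" "v \<noteq> 0" using nz by auto
    have root: "\<exists>x. poly q x = 0" if "Polynomial.degree q = 1" for q :: "rat poly"
    proof -
      obtain b q' where q': "q = pCons b q'" by (rule pCons_cases)
      then have "q' \<noteq> 0" "Polynomial.degree q' = 0" using that by (auto split: if_splits)
      then obtain c where "q' = [:c:]" "c \<noteq> 0" by (metis degree_eq_zeroE pCons_0_0)
      then have q: "q = [:b, c:]" "c \<noteq> 0" using q' by simp_all
      then show ?thesis unfolding q by (intro exI[of _ "- b / c"]) simp
    qed
    have "Polynomial.degree u \<noteq> 1" "Polynomial.degree v \<noteq> 1" using root nr uv by fastforce+
    moreover have "Polynomial.degree u + Polynomial.degree v = Polynomial.degree p"
      using uv uv0 by (metis deg degree_mult_eq)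
    ultimately have "Polynomial.degree u = 0 \<or> Polynomial.degree v = 0" using assms(2) by auto
    then show "is_unit u \<or> is_unit v" using uv0 by (auto simp: is_unit_iff_degree)
  qed
qed

lemma galois_group_embedding:
  assumes "\<sigma> \<in> carrier (galois_group f)"
  shows "complex_embedding (splitting_field f) \<sigma>"
proof -
  interpret complex_subfield "splitting_field f"
    unfolding splitting_field_def by (rule complex_subfield_rat_adjoin)
  show ?thesis
    by unfold_locales
      (use assms in \<open>auto simp: galois_group_def rat_automorphisms_def ring_hom_def complex_ring_simps\<close>)
qed

lemma galois_group_Bij: "\<sigma> \<in> carrier (galois_group f) \<Longrightarrow> \<sigma> \<in> Bij (splitting_field f)"
  by (simp add: galois_group_def rat_automorphisms_def)

lemma galois_group_mult:
  assumes "\<sigma> \<in> carrier (galois_group f)" "\<tau> \<in> carrier (galois_group f)"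
  shows "\<sigma> \<otimes>\<^bsub>galois_group f\<^esub> \<tau> = compose (splitting_field f) \<sigma> \<tau>"
  using assms[THEN galois_group_Bij] by (simp add: galois_group_def BijGroup_def)

lemma galois_group_eqI:
  assumes "\<sigma> \<in> carrier (galois_group f)" "\<tau> \<in> carrier (galois_group f)"
    and eq: "\<And>x. x \<in> complex_roots f \<Longrightarrow> \<sigma> x = \<tau> x"
  shows "\<sigma> = \<tau>"
proof (rule extensionalityI)
  let ?K = "splitting_field f"
  show "\<sigma> \<in> extensional ?K" "\<tau> \<in> extensional ?K"
    using assms(1,2)[THEN galois_group_Bij] by (simp_all add: Bij_imp_extensional)
  interpret s: complex_embedding ?K \<sigma> by (rule galois_group_embedding) fact
  interpret t: complex_embedding ?K \<tau> by (rule galois_group_embedding) fact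
  have "complex_subfield {x \<in> ?K. \<sigma> x = \<tau> x}"
    by unfold_locales (auto simp: s.hom_one t.hom_one s.hom_add t.hom_add s.hom_mult t.hom_mult
        s.hom_uminus t.hom_uminus s.hom_inverse t.hom_inverse intro: s.closed_intros s.inverse_closed)
  moreover have "complex_roots f \<subseteq> {x \<in> ?K. \<sigma> x = \<tau> x}"
    using eq rat_adjoin_superset by (auto simp: splitting_field_def)
  ultimately have "?K \<subseteq> {x \<in> ?K. \<sigma> x = \<tau> x}"
    unfolding splitting_field_def by (rule rat_adjoin_minimal)
  then show "\<sigma> x = \<tau> x" if "x \<in> ?K" for x using that by blast
qed

lemma galois_group_rat_eval:
  assumes "\<sigma> \<in> carrier (galois_group f)" "x \<in> splitting_field f" "rat_eval h x = 0"
  shows "rat_eval h (\<sigma> x) = 0"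
proof -
  interpret s: complex_embedding "splitting_field f" \<sigma> by (rule galois_group_embedding) fact
  have p: "map_poly of_rat h \<in> s.polys" using s.Rats_closed by (auto simp: s.polys_def coeff_map_poly)
  have "map_poly \<sigma> (map_poly of_rat h) = map_poly of_rat h"
    by (rule poly_eqI) (simp add: coeff_map_poly s.hom_zero s.hom_Rats)
  then show ?thesis using s.hom_poly[OF p assms(2)] assms(3) s.hom_zero by simp
qed

lemma galois_group_orbit_stabilizer:
  assumes nz: "f \<noteq> 0" and irr: "Factorial_Ring.irreducible h"
    and sub: "{z. rat_eval h z = 0} \<subseteq> splitting_field f" and x: "rat_eval h x = 0"
  shows "card {z. rat_eval h z = 0} * card {\<sigma> \<in> carrier (galois_group f). \<sigma> x = x} = Coset.order (galois_group f)"
proof -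
  let ?G = "galois_group f" and ?K = "splitting_field f"
  define E where "E = {z. rat_eval h z = 0}"
  have EK: "E \<subseteq> ?K" using sub by (simp add: E_def)
  have "map_poly of_rat h \<noteq> (0 :: complex poly)" using irr by (auto simp: map_poly_eq_0_iff)
  then have fin: "finite E" unfolding E_def by (rule poly_roots_finite)
  have maps: "\<sigma> z \<in> E" if "\<sigma> \<in> carrier ?G" "z \<in> E" for \<sigma> z
    using that galois_group_rat_eval[of \<sigma> f z h] EK by (auto simp: E_def)
  have bij: "restrict \<sigma> E \<in> Bij E" if s: "\<sigma> \<in> carrier ?G" for \<sigma>
  proof -
    have "inj_on \<sigma> ?K" using galois_group_Bij[OF s] by (simp add: Bij_def bij_betw_def)
    then have "inj_on \<sigma> E" using EK inj_on_subset by blast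
    moreover have "\<sigma> ` E \<subseteq> E" using maps[OF s] by blast
    ultimately have "bij_betw \<sigma> E E" using fin by (simp add: bij_betw_def endo_inj_surj)
    then show ?thesis by (simp add: Bij_def bij_betw_def inj_on_def)
  qed
  have "(\<lambda>\<sigma>. restrict \<sigma> E) \<in> hom ?G (BijGroup E)"
  proof (rule homI)
    fix \<sigma> \<tau> assume st: "\<sigma> \<in> carrier ?G" "\<tau> \<in> carrier ?G"
    show "restrict (\<sigma> \<otimes>\<^bsub>?G\<^esub> \<tau>) E = restrict \<sigma> E \<otimes>\<^bsub>BijGroup E\<^esub> restrict \<tau> E"
      using bij[OF st(1)] bij[OF st(2)] EK maps[OF st(2)]
      by (auto simp: galois_group_mult[OF st] BijGroup_def compose_def fun_eq_iff)
  qed (use bij in \<open>auto simp: BijGroup_def\<close>)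
  then have "group_hom ?G (BijGroup E) (\<lambda>\<sigma>. restrict \<sigma> E)"
    by (simp add: group_hom_def group_hom_axioms_def group_galois_group group_BijGroup)
  then interpret act: group_action ?G E "\<lambda>\<sigma>. restrict \<sigma> E" by (rule group_action.intro)
  have xE: "x \<in> E" using x by (simp add: E_def)
  have "orbit ?G (\<lambda>\<sigma>. restrict \<sigma> E) x = E"
  proof
    show "orbit ?G (\<lambda>\<sigma>. restrict \<sigma> E) x \<subseteq> E" using maps xE by (auto simp: orbit_def)
    show "E \<subseteq> orbit ?G (\<lambda>\<sigma>. restrict \<sigma> E) x"
      using galois_group_conjugate[OF nz _ irr x] xE EK by (fastforce simp: orbit_def E_def)
  qed
  moreover have "stabilizer ?G (\<lambda>\<sigma>. restrict \<sigma> E) x = {\<sigma> \<in> carrier ?G. \<sigma> x = x}"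
    using xE by (auto simp: stabilizer_def)
  ultimately show ?thesis using act.orbit_stabilizer_theorem[OF xE] by (simp add: E_def)
qed

definition vandermonde4 :: "(nat \<Rightarrow> complex) \<Rightarrow> complex"
  where "vandermonde4 q = (q 1 - q 2) * (q 1 - q 3) * (q 1 - q 4) * (q 2 - q 3) * (q 2 - q 4) * (q 3 - q 4)"

lemma atLeastAtMost_1_4: "{1..4::nat} = {1, 2, 3, 4}"
  by auto

lemma vandermonde4_transpose:
  assumes "i \<in> {1..4}" "j \<in> {1..4}" "i \<noteq> j"
  shows "vandermonde4 (q \<circ> Transposition.transpose i j) = - vandermonde4 q"
proof -
  have "vandermonde4 (q \<circ> Transposition.transpose i j) = - vandermonde4 q"
    if "(i, j) \<in> {(1, 2), (1, 3), (1, 4), (2, 3), (2, 4), (3, 4)}" for i j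
  proof -
    obtain x12 x13 x14 x23 x24 x34 where x:
      "q 1 - q 2 = x12" "q 1 - q 3 = x13" "q 1 - q 4 = x14" "q 2 - q 3 = x23" "q 2 - q 4 = x24" "q 3 - q 4 = x34"
      by blast
    have y: "q 2 - q 1 = - x12" "q 3 - q 1 = - x13" "q 4 - q 1 = - x14" "q 3 - q 2 = - x23" "q 4 - q 2 = - x24" "q 4 - q 3 = - x34"
      by (simp_all flip: x)
    from that consider "i = 1" "j = 2" | "i = 1" "j = 3" | "i = 1" "j = 4" | "i = 2" "j = 3" | "i = 2" "j = 4" | "i = 3" "j = 4"
      by auto
    then show ?thesis
      by cases (simp_all add: vandermonde4_def transpose_def x y mult_ac del: One_nat_def)
  qed
  moreover have "(i, j) \<in> {(1, 2), (1, 3), (1, 4), (2, 3), (2, 4), (3, 4)} \<or>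
      (j, i) \<in> {(1, 2), (1, 3), (1, 4), (2, 3), (2, 4), (3, 4)}"
    using assms unfolding atLeastAtMost_1_4 by auto
  ultimately show ?thesis by (metis transpose_commute)
qed

lemma vandermonde4_permutes:
  assumes "p permutes {1..4}"
  shows "vandermonde4 (q \<circ> p) = of_int (sign p) * vandermonde4 q"
  using assms finite_atLeastAtMost
proof (induction p arbitrary: q rule: permutes_induct)
  case id
  then show ?case by (simp add: sign_id)
next
  case (swap i j p)
  have "permutation p" using swap by (auto simp: permutation_permutes)
  then have sgn: "sign (Transposition.transpose i j \<circ> p) = - sign p"
    using swap by (simp add: sign_compose permutation_swap_id sign_swap_id)
  have "vandermonde4 (q \<circ> (Transposition.transpose i j \<circ> p))
      = of_int (sign p) * vandermonde4 (q \<circ> Transposition.transpose i j)"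
    using swap.IH[of "q \<circ> Transposition.transpose i j"] by (simp only: comp_assoc)
  also have "\<dots> = of_int (- sign p) * vandermonde4 q"
    unfolding vandermonde4_transpose[OF swap.hyps(1-3)] by simp
  finally show ?case unfolding sgn .
qed

locale quartic_roots =
  fixes a d :: int and f :: "int poly" and r :: "nat \<Rightarrow> complex"
  assumes f_def: "f = [:d, 0, 0, a, 1:]"
    and irr: "Factorial_Ring.irreducible (map_poly rat_of_int f)"
    and d_nonzero: "d \<noteq> 0"
    and sym1: "r 1 + r 2 + r 3 + r 4 = - of_int a"
    and sym2: "r 1 * r 2 + r 1 * r 3 + r 1 * r 4 + r 2 * r 3 + r 2 * r 4 + r 3 * r 4 = 0"
    and sym3: "r 1 * r 2 * r 3 + r 1 * r 2 * r 4 + r 1 * r 3 * r 4 + r 2 * r 3 * r 4 = 0"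
    and sym4: "r 1 * r 2 * r 3 * r 4 = of_int d"

lemma quartic_roots_exist:
  assumes "f = [:d, 0, 0, a, 1:]" "Factorial_Ring.irreducible (map_poly rat_of_int f)" "d \<noteq> 0"
  shows "\<exists>r. quartic_roots a d f r"
proof -
  define P :: "complex poly" where "P = [:of_int d, 0, 0, of_int a, 1:]"
  have root: "\<exists>z q'. q = [:- z, 1:] * q' \<and> Polynomial.degree q' = n"
    if deg: "Polynomial.degree q = Suc n" for q :: "complex poly" and n
  proof -
    obtain z where "poly q z = 0" using alg_closed_imp_poly_has_root[of q] deg by auto
    then obtain q' where q': "q = [:- z, 1:] * q'" by (auto simp: poly_eq_0_iff_dvd)
    have "q \<noteq> 0" using deg by auto
    then have "q' \<noteq> 0" using q' by auto
    then have "Polynomial.degree q = 1 + Polynomial.degree q'" unfolding q' by (subst degree_mult_eq) auto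
    then show ?thesis using q' deg by auto
  qed
  have "Polynomial.degree P = Suc (Suc (Suc (Suc 0)))" by (simp add: P_def)
  then obtain z1 q1 where 1: "P = [:- z1, 1:] * q1" "Polynomial.degree q1 = Suc (Suc (Suc 0))"
    using root by blast
  obtain z2 q2 where 2: "q1 = [:- z2, 1:] * q2" "Polynomial.degree q2 = Suc (Suc 0)"
    using root[OF 1(2)] by auto
  obtain z3 q3 where 3: "q2 = [:- z3, 1:] * q3" "Polynomial.degree q3 = Suc 0"
    using root[OF 2(2)] by auto
  obtain z4 q4 where 4: "q3 = [:- z4, 1:] * q4" "Polynomial.degree q4 = 0"
    using root[OF 3(2)] by auto
  obtain c where c: "q4 = [:c:]" using 4(2) by (meson degree_eq_zeroE)
  have eq: "[:of_int d, 0, 0, of_int a, 1:] = [:- z1, 1:] * ([:- z2, 1:] * ([:- z3, 1:] * ([:- z4, 1:] * [:c:])))"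
    unfolding P_def[symmetric] 1(1) 2(1) 3(1) 4(1) c ..
  then have c1: "c = 1" by simp
  define r where "r = (\<lambda>i::nat. if i = 1 then z1 else if i = 2 then z2 else if i = 3 then z3 else z4)"
  have r: "r 1 = z1" "r 2 = z2" "r 3 = z3" "r 4 = z4" by (simp_all add: r_def)
  have e: "of_int a = - z1 - z2 - z3 - z4"
    "0 = z1 * z2 + z1 * z3 + z1 * z4 + z2 * z3 + z2 * z4 + z3 * z4"
    "0 = - (z1 * z2 * z3 + z1 * z2 * z4 + z1 * z3 * z4 + z2 * z3 * z4)"
    "of_int d = z1 * z2 * z3 * z4"
    using eq c1 by (simp_all add: algebra_simps)
  have e3: "z1 * z2 * z3 + z1 * z2 * z4 + z1 * z3 * z4 + z2 * z3 * z4 = 0"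
    by (metis e(3) neg_equal_0_iff_equal)
  have "quartic_roots a d f r"
    by unfold_locales (use assms e(1,2,4) e3 in \<open>simp_all only: r, simp_all\<close>)
  then show ?thesis by blast
qed

context quartic_roots
begin

lemma f_nonzero: "f \<noteq> 0"
  by (simp add: f_def)

lemma poly_f: "poly (map_poly of_int f) z = (z - r 1) * (z - r 2) * (z - r 3) * (z - r 4)"
proof -
  have "(z - r 1) * (z - r 2) * (z - r 3) * (z - r 4) = z ^ 4 - (r 1 + r 2 + r 3 + r 4) * z ^ 3
      + (r 1 * r 2 + r 1 * r 3 + r 1 * r 4 + r 2 * r 3 + r 2 * r 4 + r 3 * r 4) * z ^ 2
      - (r 1 * r 2 * r 3 + r 1 * r 2 * r 4 + r 1 * r 3 * r 4 + r 2 * r 3 * r 4) * z + r 1 * r 2 * r 3 * r 4"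
    by (simp add: algebra_simps power2_eq_square power3_eq_cube power4_eq_xxxx)
  then show ?thesis
    unfolding sym1 sym2 sym3 sym4
    by (simp add: f_def map_poly_pCons algebra_simps power2_eq_square power3_eq_cube power4_eq_xxxx)
qed

lemma complex_roots_eq: "complex_roots f = r ` {1..4}"
  unfolding complex_roots_def poly_f atLeastAtMost_1_4 by auto

lemma root_in_splitting_field: "i \<in> {1..4} \<Longrightarrow> r i \<in> splitting_field f"
  using rat_adjoin_superset[of "complex_roots f"] by (auto simp: splitting_field_def complex_roots_eq)

definition disc :: int where "disc = d ^ 2 * (256 * d - 27 * a ^ 4)"

text \<open>The discriminant is the product of the values \<open>f'(r\<^sub>i) = r\<^sub>i\<^sup>2 (4 r\<^sub>i + 3 a)\<close>.\<close>
lemma vandermonde4_square: "vandermonde4 r ^ 2 = of_int disc"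
proof -
  have deriv: "(x - y) * (x - z) * (x - w) = x ^ 2 * (4 * x + 3 * of_int a)"
    if "x + y + z + w = - of_int a" "x * y + x * z + x * w + y * z + y * w + z * w = 0"
      "x * y * z + x * y * w + x * z * w + y * z * w = 0" for x y z w :: complex
  proof -
    have "(x - y) * (x - z) * (x - w) - x ^ 2 * (4 * x - 3 * (x + y + z + w))
        = 2 * x * (x * y + x * z + x * w + y * z + y * w + z * w) - (x * y * z + x * y * w + x * z * w + y * z * w)"
      by (simp add: algebra_simps power2_eq_square)
    then show ?thesis using that by simp
  qed
  have "vandermonde4 r ^ 2 = ((r 1 - r 2) * (r 1 - r 3) * (r 1 - r 4)) * ((r 2 - r 1) * (r 2 - r 3) * (r 2 - r 4))
      * ((r 3 - r 1) * (r 3 - r 2) * (r 3 - r 4)) * ((r 4 - r 1) * (r 4 - r 2) * (r 4 - r 3))"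
  proof -
    obtain x12 x13 x14 x23 x24 x34 where x: "r 1 - r 2 = x12" "r 1 - r 3 = x13" "r 1 - r 4 = x14"
      "r 2 - r 3 = x23" "r 2 - r 4 = x24" "r 3 - r 4 = x34"
      by blast
    have y: "r 2 - r 1 = - x12" "r 3 - r 1 = - x13" "r 4 - r 1 = - x14" "r 3 - r 2 = - x23"
      "r 4 - r 2 = - x24" "r 4 - r 3 = - x34"
      by (simp_all flip: x)
    show ?thesis unfolding vandermonde4_def x y by (simp add: power2_eq_square mult_ac)
  qed
  also have "(r 1 - r 2) * (r 1 - r 3) * (r 1 - r 4) = r 1 ^ 2 * (4 * r 1 + 3 * of_int a)"
    by (rule deriv) (use sym1 sym2 sym3 in \<open>simp_all add: algebra_simps\<close>)
  also have "(r 2 - r 1) * (r 2 - r 3) * (r 2 - r 4) = r 2 ^ 2 * (4 * r 2 + 3 * of_int a)"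
    by (rule deriv) (use sym1 sym2 sym3 in \<open>simp_all add: algebra_simps\<close>)
  also have "(r 3 - r 1) * (r 3 - r 2) * (r 3 - r 4) = r 3 ^ 2 * (4 * r 3 + 3 * of_int a)"
    by (rule deriv) (use sym1 sym2 sym3 in \<open>simp_all add: algebra_simps\<close>)
  also have "(r 4 - r 1) * (r 4 - r 2) * (r 4 - r 3) = r 4 ^ 2 * (4 * r 4 + 3 * of_int a)"
    by (rule deriv) (use sym1 sym2 sym3 in \<open>simp_all add: algebra_simps\<close>)
  also have "r 1 ^ 2 * (4 * r 1 + 3 * of_int a) * (r 2 ^ 2 * (4 * r 2 + 3 * of_int a)) *
      (r 3 ^ 2 * (4 * r 3 + 3 * of_int a)) * (r 4 ^ 2 * (4 * r 4 + 3 * of_int a)) =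
      (r 1 * r 2 * r 3 * r 4) ^ 2 * ((4 * r 1 + 3 * of_int a) * (4 * r 2 + 3 * of_int a) *
      (4 * r 3 + 3 * of_int a) * (4 * r 4 + 3 * of_int a))"
    by (simp add: power_mult_distrib mult_ac)
  also have "(4 * r 1 + x) * (4 * r 2 + x) * (4 * r 3 + x) * (4 * r 4 + x) = 256 * (r 1 * r 2 * r 3 * r 4)
      + 64 * x * (r 1 * r 2 * r 3 + r 1 * r 2 * r 4 + r 1 * r 3 * r 4 + r 2 * r 3 * r 4)
      + 16 * x ^ 2 * (r 1 * r 2 + r 1 * r 3 + r 1 * r 4 + r 2 * r 3 + r 2 * r 4 + r 3 * r 4)
      + 4 * x ^ 3 * (r 1 + r 2 + r 3 + r 4) + x ^ 4" for x
    by (simp add: algebra_simps power2_eq_square power3_eq_cube power4_eq_xxxx)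
  also have "256 * (r 1 * r 2 * r 3 * r 4)
      + 64 * (3 * of_int a) * (r 1 * r 2 * r 3 + r 1 * r 2 * r 4 + r 1 * r 3 * r 4 + r 2 * r 3 * r 4)
      + 16 * (3 * of_int a) ^ 2 * (r 1 * r 2 + r 1 * r 3 + r 1 * r 4 + r 2 * r 3 + r 2 * r 4 + r 3 * r 4)
      + 4 * (3 * of_int a) ^ 3 * (r 1 + r 2 + r 3 + r 4) + (3 * of_int a) ^ 4
      = (256 * of_int d - 27 * of_int a ^ 4 :: complex)"
    unfolding sym1 sym2 sym3 sym4 by (simp add: power_mult_distrib power3_eq_cube power4_eq_xxxx)
  finally show ?thesis unfolding sym4 by (simp add: disc_def)
qed

lemma disc_nonzero: "disc \<noteq> 0"
proof
  assume "disc = 0"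
  then have "256 * d = 27 * a ^ 4" using d_nonzero by (simp add: disc_def)
  then have "256 * rat_of_int d = 27 * of_int a ^ 4"
    by (metis of_int_mult of_int_numeral of_int_power)
  moreover have "poly (map_poly rat_of_int f) (- 3 / 4 * of_int a) = (256 * of_int d - 27 * of_int a ^ 4) / 256"
    by (simp add: f_def map_poly_pCons algebra_simps power4_eq_xxxx)
  ultimately have "poly (map_poly rat_of_int f) (- 3 / 4 * of_int a) = 0" by simp
  moreover have "Polynomial.degree (map_poly rat_of_int f) = 4" by (simp add: f_def map_poly_pCons)
  ultimately show False using irreducible_poly_no_root[OF irr] by simp
qed

lemma vandermonde4_nonzero: "vandermonde4 r \<noteq> 0"
  by (metis disc_nonzero of_int_eq_0_iff vandermonde4_square zero_power2)

lemma inj_on_roots: "inj_on r {1..4}"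
  using vandermonde4_nonzero unfolding atLeastAtMost_1_4 by (auto simp: vandermonde4_def inj_on_def)

definition y1 :: complex where "y1 = r 1 * r 2 + r 3 * r 4"
definition y2 :: complex where "y2 = r 1 * r 3 + r 2 * r 4"
definition y3 :: complex where "y3 = r 1 * r 4 + r 2 * r 3"

definition resolvent :: "int poly" where "resolvent = [:- (a ^ 2 * d), - 4 * d, 0, 1:]"

lemma poly_resolvent: "poly (map_poly of_int resolvent) z = (z - y1) * (z - y2) * (z - y3)"
proof -
  have 1: "y1 + y2 + y3 = 0" unfolding y1_def y2_def y3_def using sym2 by (simp add: algebra_simps)
  have "y1 * y2 + y1 * y3 + y2 * y3 = (r 1 + r 2 + r 3 + r 4) *
      (r 1 * r 2 * r 3 + r 1 * r 2 * r 4 + r 1 * r 3 * r 4 + r 2 * r 3 * r 4) - 4 * (r 1 * r 2 * r 3 * r 4)"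
    unfolding y1_def y2_def y3_def by (simp add: algebra_simps)
  then have 2: "y1 * y2 + y1 * y3 + y2 * y3 = - 4 * of_int d" unfolding sym3 sym4 by simp
  have "y1 * y2 * y3 = (r 1 + r 2 + r 3 + r 4) ^ 2 * (r 1 * r 2 * r 3 * r 4)
      + (r 1 * r 2 * r 3 + r 1 * r 2 * r 4 + r 1 * r 3 * r 4 + r 2 * r 3 * r 4) ^ 2
      - 4 * (r 1 * r 2 + r 1 * r 3 + r 1 * r 4 + r 2 * r 3 + r 2 * r 4 + r 3 * r 4) * (r 1 * r 2 * r 3 * r 4)"
    unfolding y1_def y2_def y3_def by (simp add: algebra_simps power2_eq_square)
  then have 3: "y1 * y2 * y3 = of_int a ^ 2 * of_int d" unfolding sym1 sym2 sym3 sym4 by simp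
  have "(z - y1) * (z - y2) * (z - y3) = z ^ 3 - (y1 + y2 + y3) * z ^ 2
      + (y1 * y2 + y1 * y3 + y2 * y3) * z - y1 * y2 * y3"
    by (simp add: algebra_simps power2_eq_square power3_eq_cube)
  then show ?thesis unfolding 1 2 3
    by (simp add: resolvent_def map_poly_pCons algebra_simps power2_eq_square power3_eq_cube)
qed

lemma resolvent_roots_distinct: "y1 \<noteq> y2" "y1 \<noteq> y3" "y2 \<noteq> y3"
proof -
  have "r 1 \<noteq> r 2" "r 1 \<noteq> r 3" "r 1 \<noteq> r 4" "r 2 \<noteq> r 3" "r 2 \<noteq> r 4" "r 3 \<noteq> r 4"
    using vandermonde4_nonzero by (auto simp: vandermonde4_def)
  moreover have "y1 - y2 = (r 1 - r 4) * (r 2 - r 3)" "y1 - y3 = (r 1 - r 3) * (r 2 - r 4)"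
    "y2 - y3 = (r 1 - r 2) * (r 3 - r 4)"
    by (simp_all add: y1_def y2_def y3_def algebra_simps)
  ultimately show "y1 \<noteq> y2" "y1 \<noteq> y3" "y2 \<noteq> y3" by auto
qed

definition root_perm :: "(complex \<Rightarrow> complex) \<Rightarrow> nat \<Rightarrow> nat"
  where "root_perm \<sigma> i = (if i \<in> {1..4} then the_inv_into {1..4} r (\<sigma> (r i)) else i)"

context
  fixes \<sigma> assumes \<sigma>: "\<sigma> \<in> carrier (galois_group f)"
begin

interpretation s: complex_embedding "splitting_field f" \<sigma>
  by (rule galois_group_embedding) (rule \<sigma>)

lemma root_perm: assumes "i \<in> {1..4}" shows "root_perm \<sigma> i \<in> {1..4}" "r (root_perm \<sigma> i) = \<sigma> (r i)"
proof -
  have "r i \<in> complex_roots f" using assms complex_roots_eq by blast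
  then have "\<sigma> (r i) \<in> complex_roots f"
    using galois_group_rat_eval[OF \<sigma> root_in_splitting_field[OF assms], of "map_poly rat_of_int f"]
    by (simp add: complex_roots_def map_poly_of_rat_of_int)
  then have "\<sigma> (r i) \<in> r ` {1..4}" by (simp add: complex_roots_eq)
  then show "root_perm \<sigma> i \<in> {1..4}" "r (root_perm \<sigma> i) = \<sigma> (r i)"
    using assms inj_on_roots the_inv_into_into[of r "{1..4}" "\<sigma> (r i)" "{1..4}"]
    by (auto simp: root_perm_def f_the_inv_into_f)
qed

lemma root_perm_permutes: "root_perm \<sigma> permutes {1..4}"
proof (rule bij_imp_permutes)
  have "inj_on (root_perm \<sigma>) {1..4}"
  proof (rule inj_onI)
    fix i j :: nat assume ij: "i \<in> {1..4}" "j \<in> {1..4}" "root_perm \<sigma> i = root_perm \<sigma> j"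
    then have "\<sigma> (r i) = \<sigma> (r j)" using root_perm(2) by metis
    then have "r i = r j"
      using s.inj_on_hom root_in_splitting_field ij(1,2) by (meson inj_on_eq_iff)
    then show "i = j" using inj_on_roots ij(1,2) by (meson inj_on_eq_iff)
  qed
  moreover have "root_perm \<sigma> ` {1..4} \<subseteq> {1..4}" using root_perm(1) by blast
  ultimately show "bij_betw (root_perm \<sigma>) {1..4} {1..4}" by (simp add: bij_betw_def endo_inj_surj)
qed (simp only: root_perm_def if_False)

lemma hom_vandermonde4: "\<sigma> (vandermonde4 r) = of_int (sign (root_perm \<sigma>)) * vandermonde4 r"
proof -
  have "\<sigma> (vandermonde4 r) = vandermonde4 (r \<circ> root_perm \<sigma>)"
    by (simp add: vandermonde4_def root_perm(2) root_in_splitting_field s.hom_mult s.hom_diff s.mult_closed s.diff_closed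
        del: One_nat_def)
  then show ?thesis using vandermonde4_permutes[OF root_perm_permutes] by simp
qed

end

lemma root_perm_mult:
  assumes "\<sigma> \<in> carrier (galois_group f)" "\<tau> \<in> carrier (galois_group f)"
  shows "root_perm (\<sigma> \<otimes>\<^bsub>galois_group f\<^esub> \<tau>) = root_perm \<sigma> \<circ> root_perm \<tau>"
proof
  fix i
  show "root_perm (\<sigma> \<otimes>\<^bsub>galois_group f\<^esub> \<tau>) i = (root_perm \<sigma> \<circ> root_perm \<tau>) i"
  proof (cases "i \<in> {1..4}")
    case True
    note \<tau>i = root_perm[OF assms(2) True]
    have "(\<sigma> \<otimes>\<^bsub>galois_group f\<^esub> \<tau>) (r i) = \<sigma> (r (root_perm \<tau> i))"
      using root_in_splitting_field[OF True] \<tau>i(2) by (simp add: galois_group_mult[OF assms] compose_eq)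
    then show ?thesis using True \<tau>i(1) by (simp add: root_perm_def)
  qed (auto simp: root_perm_def)
qed

lemma root_perm_hom: "root_perm \<in> hom (galois_group f) (sym_group 4)"
  by (rule homI) (simp_all add: sym_group_def root_perm_permutes root_perm_mult del: One_nat_def)

lemma inj_on_root_perm: "inj_on root_perm (carrier (galois_group f))"
proof (rule inj_onI)
  fix \<sigma> \<tau> assume st: "\<sigma> \<in> carrier (galois_group f)" "\<tau> \<in> carrier (galois_group f)" "root_perm \<sigma> = root_perm \<tau>"
  show "\<sigma> = \<tau>"
  proof (rule galois_group_eqI[OF st(1,2)])
    fix x assume "x \<in> complex_roots f"
    then show "\<sigma> x = \<tau> x" unfolding complex_roots_eq using root_perm(2)[OF st(1)] root_perm(2)[OF st(2)] st(3) by auto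
  qed
qed

lemma vandermonde4_in_splitting_field: "vandermonde4 r \<in> splitting_field f"
proof -
  interpret complex_subfield "splitting_field f"
    unfolding splitting_field_def by (rule complex_subfield_rat_adjoin)
  show ?thesis unfolding vandermonde4_def
    by (intro mult_closed diff_closed root_in_splitting_field) auto
qed

lemma order_eq_4_times_stabilizer:
  assumes "i \<in> {1..4}"
  shows "Coset.order (galois_group f) = 4 * card {\<sigma> \<in> carrier (galois_group f). \<sigma> (r i) = r i}"
proof -
  have roots: "{z. rat_eval (map_poly rat_of_int f) z = 0} = complex_roots f"
    by (simp add: map_poly_of_rat_of_int complex_roots_def)
  have "card (complex_roots f) = 4" by (simp add: complex_roots_eq card_image inj_on_roots del: One_nat_def)
  moreover have "rat_eval (map_poly rat_of_int f) (r i) = 0" using roots complex_roots_eq assms by blast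
  moreover have "complex_roots f \<subseteq> splitting_field f"
    unfolding splitting_field_def by (rule rat_adjoin_superset)
  ultimately show ?thesis
    using galois_group_orbit_stabilizer[OF f_nonzero irr, of "r i"] unfolding roots by simp
qed

lemma three_dvd_order:
  assumes "\<And>k. poly resolvent k \<noteq> 0"
  shows "3 dvd Coset.order (galois_group f)"
proof -
  interpret complex_subfield "splitting_field f"
    unfolding splitting_field_def by (rule complex_subfield_rat_adjoin)
  have ir: "Factorial_Ring.irreducible (map_poly rat_of_int resolvent)"
    by (rule irreducible_rat_poly_no_root) (use assms in \<open>simp_all add: resolvent_def\<close>)
  have roots: "{z. rat_eval (map_poly rat_of_int resolvent) z = 0} = {y1, y2, y3}"
    by (auto simp: map_poly_of_rat_of_int poly_resolvent)
  have "{y1, y2, y3} \<subseteq> splitting_field f"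
    by (auto simp: y1_def y2_def y3_def intro!: add_closed mult_closed root_in_splitting_field)
  moreover have "card {y1, y2, y3} = 3" using resolvent_roots_distinct by simp
  moreover have "rat_eval (map_poly rat_of_int resolvent) y1 = 0" using roots by blast
  ultimately have "Coset.order (galois_group f) = 3 * card {\<sigma> \<in> carrier (galois_group f). \<sigma> y1 = y1}"
    using galois_group_orbit_stabilizer[OF f_nonzero ir, of y1] unfolding roots by simp
  then show ?thesis by simp
qed

lemma twelve_dvd_order:
  assumes "\<And>k. poly resolvent k \<noteq> 0"
  shows "12 dvd Coset.order (galois_group f)"
proof -
  have "4 dvd Coset.order (galois_group f)" using order_eq_4_times_stabilizer[of 1] by simp
  then show ?thesis using three_dvd_order[OF assms] by presburger
qed

end

section \<open>Subgroups of the symmetric group of degree four\<close>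

lemma iso_of_common_image:
  assumes inj: "inj_on \<phi> (carrier G)" "inj_on \<psi> (carrier H)"
    and image: "\<phi> ` carrier G = \<psi> ` carrier H"
    and closed: "\<And>x y. x \<in> carrier H \<Longrightarrow> y \<in> carrier H \<Longrightarrow> x \<otimes>\<^bsub>H\<^esub> y \<in> carrier H"
      "\<And>x y. x \<in> carrier G \<Longrightarrow> y \<in> carrier G \<Longrightarrow> x \<otimes>\<^bsub>G\<^esub> y \<in> carrier G"
    and hom: "\<And>x y. x \<in> carrier G \<Longrightarrow> y \<in> carrier G \<Longrightarrow> \<phi> (x \<otimes>\<^bsub>G\<^esub> y) = m (\<phi> x) (\<phi> y)"
      "\<And>x y. x \<in> carrier H \<Longrightarrow> y \<in> carrier H \<Longrightarrow> \<psi> (x \<otimes>\<^bsub>H\<^esub> y) = m (\<psi> x) (\<psi> y)"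
  shows "G \<cong> H"
proof -
  define h where "h = inv_into (carrier H) \<psi> \<circ> \<phi>"
  have h: "h x \<in> carrier H" "\<psi> (h x) = \<phi> x" if "x \<in> carrier G" for x
  proof -
    have "\<phi> x \<in> \<psi> ` carrier H" using that image by blast
    then show "h x \<in> carrier H" "\<psi> (h x) = \<phi> x"
      by (simp_all add: h_def inv_into_into f_inv_into_f)
  qed
  have "h \<in> iso G H"
  proof (rule isoI)
    show "h \<in> hom G H"
    proof (rule homI)
      fix x y assume xy: "x \<in> carrier G" "y \<in> carrier G"
      have "\<psi> (h (x \<otimes>\<^bsub>G\<^esub> y)) = \<psi> (h x \<otimes>\<^bsub>H\<^esub> h y)"
        using xy h closed hom by simp
      then show "h (x \<otimes>\<^bsub>G\<^esub> y) = h x \<otimes>\<^bsub>H\<^esub> h y"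
        using xy h closed inj(2) by (meson inj_on_eq_iff)
    qed (rule h)
    have "bij_betw \<phi> (carrier G) (\<psi> ` carrier H)" using inj(1) image by (simp add: bij_betw_def)
    moreover have "bij_betw (inv_into (carrier H) \<psi>) (\<psi> ` carrier H) (carrier H)"
      using inj(2) by (intro bij_betw_inv_into) (simp add: bij_betw_def)
    ultimately show "bij_betw h (carrier G) (carrier H)" unfolding h_def by (rule bij_betw_trans)
  qed
  then show ?thesis by (auto simp: is_iso_def)
qed

lemma (in group) index_2_square:
  assumes H: "subgroup H G" and fin: "finite (carrier G)" and index: "card (carrier G) = 2 * card H"
    and x: "x \<in> carrier G"
  shows "x \<otimes> x \<in> H"
proof (cases "x \<in> H")
  case True
  then show ?thesis using H by (simp add: subgroup.m_closed)
next
  case False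
  interpret H: subgroup H G by fact
  define C where "C = (\<lambda>h. x \<otimes> h) ` H"
  have C: "C \<subseteq> carrier G" unfolding C_def using x by auto
  have "inj_on (\<lambda>h. x \<otimes> h) H" using x by (auto simp: inj_on_def)
  then have "card C = card H" unfolding C_def by (rule card_image)
  moreover have disj: "C \<inter> H = {}"
  proof (rule ccontr)
    assume "C \<inter> H \<noteq> {}"
    then obtain h where h: "h \<in> H" "x \<otimes> h \<in> H" unfolding C_def by auto
    then have "(x \<otimes> h) \<otimes> inv h \<in> H" by simp
    then show False using h(1) x False by (simp add: m_assoc)
  qed
  ultimately have "card (C \<union> H) = card (carrier G)"
    using index C fin H.subset by (subst card_Un_disjoint) (auto intro: finite_subset)
  then have "C \<union> H = carrier G" using C H.subset fin by (intro card_subset_eq) auto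
  moreover have "x \<otimes> x \<notin> C"
  proof
    assume "x \<otimes> x \<in> C"
    then obtain h where "h \<in> H" "x \<otimes> x = x \<otimes> h" unfolding C_def by auto
    then show False using x False by simp
  qed
  ultimately show ?thesis using x by blast
qed

lemma three_cycle_eq_square:
  assumes "c \<in> three_cycles n"
  shows "c = (c \<circ> c) \<circ> (c \<circ> c)"
proof -
  obtain cs where cs: "c = cycle_of_list cs" "cycle cs" "length cs = 3" using assms by blast
  then obtain i j k where ijk: "cs = [i, j, k]" using stupid_lemma by blast
  have "i \<noteq> j" "i \<noteq> k" "j \<noteq> k" using cs(2) ijk by auto
  then have c: "c i = j" "c j = k" "c k = i"
    by (simp_all add: cs(1) ijk)
  have "c x = c (c (c (c x)))" for x
  proof (cases "x \<in> {i, j, k}")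
    case True
    then show ?thesis using c by auto
  next
    case False
    then have "c x = x" by (simp add: cs(1) ijk id_outside_supp del: cycle_of_list.simps)
    then show ?thesis by simp
  qed
  then show ?thesis by (simp add: fun_eq_iff)
qed

text \<open>An index two subgroup contains all squares, and every 3-cycle is a square.\<close>
lemma alt_group_subset_index_2:
  assumes H: "subgroup H (sym_group n)" and index: "fact n = 2 * card H"
  shows "carrier (alt_group n) \<subseteq> H"
proof -
  interpret S: group "sym_group n" by (rule sym_group_is_group)
  have card: "card (carrier (sym_group n)) = 2 * card H" using index by (simp add: sym_group_card_carrier)
  have fin: "finite (carrier (sym_group n))"
    by (rule card_ge_0_finite) (simp add: sym_group_card_carrier)
  have sub: "carrier (alt_group n) \<subseteq> carrier (sym_group n)"
    using alt_group_is_subgroup subgroup.subset by blast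
  have "three_cycles n \<subseteq> H"
  proof
    fix c assume c: "c \<in> three_cycles n"
    then have cS: "c \<in> carrier (sym_group n)" using three_cycles_incl sub by blast
    then have "c \<circ> c \<in> carrier (sym_group n)"
      using S.m_closed[of c c] by (simp add: sym_group_mult)
    from S.index_2_square[OF H fin card this] have "(c \<circ> c) \<circ> (c \<circ> c) \<in> H" by (simp only: sym_group_mult)
    then show "c \<in> H" using three_cycle_eq_square[OF c] by simp
  qed
  then have "generate (sym_group n) (three_cycles n) \<subseteq> H"
    using H by (rule S.generate_subgroup_incl)
  moreover have "generate (alt_group n) (three_cycles n) = generate (sym_group n) (three_cycles n)"
    using S.generate_consistent[OF three_cycles_incl alt_group_is_subgroup]
    by (simp add: alt_group_def)
  ultimately show ?thesis using alt_group_carrier_as_three_cycles by metis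
qed

text \<open>The symmetries of a square with vertices labelled \<open>1, 2, 3, 4\<close> in cyclic order.\<close>
definition dihedral_perm :: "int \<times> int \<Rightarrow> nat \<Rightarrow> nat"
  where "dihedral_perm = (\<lambda>(i, e) j. if j \<in> {1..4} then nat ((i + e * int j - 1) mod 4) + 1 else j)"

lemma dihedral_perm_mult:
  assumes "x \<in> carrier (dihedral_group 4)" "y \<in> carrier (dihedral_group 4)"
  shows "dihedral_perm (x \<otimes>\<^bsub>dihedral_group 4\<^esub> y) = dihedral_perm x \<circ> dihedral_perm y"
proof
  fix j
  obtain i e k g where xy: "x = (i, e)" "y = (k, g)" "e = 1 \<or> e = -1"
    using assms by (auto simp: dihedral_group_def)
  show "dihedral_perm (x \<otimes>\<^bsub>dihedral_group 4\<^esub> y) j = (dihedral_perm x \<circ> dihedral_perm y) j"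
  proof (cases "j \<in> {1..4}")
    case True
    define w where "w = g * int j"
    have "nat ((k + w - 1) mod 4) + 1 \<in> {1..4}"
      using pos_mod_bound[of 4 "k + w - 1"] pos_mod_sign[of 4 "k + w - 1"] by auto
    moreover have "int (nat ((k + w - 1) mod 4) + 1) = (k + w - 1) mod 4 + 1" by simp
    moreover have "((i + e * k) mod 4 + e * w - 1) mod 4 = (i + e * ((k + w - 1) mod 4 + 1) - 1) mod 4"
    proof -
      have "(i + e * k) mod 4 + e * w - 1 - (i + e * ((k + w - 1) mod 4 + 1) - 1)
          = 4 * (e * ((k + w - 1) div 4) - (i + e * k) div 4)"
        unfolding minus_mult_div_eq_mod[symmetric] by (simp add: algebra_simps)
      then show ?thesis unfolding mod_eq_dvd_iff by (metis dvd_triv_left)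
    qed
    ultimately show ?thesis
      using True by (simp add: xy(1,2) dihedral_group_def dihedral_perm_def mult.assoc flip: w_def del: One_nat_def)
  qed (auto simp: dihedral_perm_def xy(1,2) dihedral_group_def)
qed

lemma permutes_4_eqI:
  assumes "p permutes {1..4::nat}" "\<And>j. j \<notin> {1..4} \<Longrightarrow> q j = j"
    and "p 1 = q 1" "p 2 = q 2" "p 3 = q 3" "p 4 = q 4"
  shows "p = q"
proof
  fix j show "p j = q j"
  proof (cases "j \<in> {1..4}")
    case True
    then show ?thesis using assms(3-6) unfolding atLeastAtMost_1_4 by auto
  next
    case False
    then show ?thesis using assms(2) permutes_not_in[OF assms(1)] by simp
  qed
qed

lemma dihedral_perm_memI:
  assumes p: "p permutes {1..4}"
    and cases: "[p 1, p 2, p 3, p 4] \<in> {[1, 2, 3, 4], [2, 3, 4, 1], [3, 4, 1, 2], [4, 1, 2, 3],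
      [1, 4, 3, 2], [2, 1, 4, 3], [3, 2, 1, 4], [4, 3, 2, 1]}"
  shows "p \<in> dihedral_perm ` carrier (dihedral_group 4)"
proof -
  have *: "p \<in> dihedral_perm ` carrier (dihedral_group 4)"
    if "[p 1, p 2, p 3, p 4] = l" "x \<in> carrier (dihedral_group 4)" "l = map (dihedral_perm x) [1, 2, 3, 4]" for x l
  proof -
    have "p = dihedral_perm x"
      by (rule permutes_4_eqI[OF p]) (use that(1,3) in \<open>auto simp: dihedral_perm_def split: prod.splits\<close>)
    then show ?thesis using that(2) by blast
  qed
  from cases show ?thesis
  proof (elim insertE emptyE)
    assume "[p 1, p 2, p 3, p 4] = [1, 2, 3, 4]"
    then show ?thesis by (rule *[of _ "(0, 1)"]) (simp_all add: dihedral_group_def dihedral_perm_def)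
  next
    assume "[p 1, p 2, p 3, p 4] = [2, 3, 4, 1]"
    then show ?thesis by (rule *[of _ "(1, 1)"]) (simp_all add: dihedral_group_def dihedral_perm_def)
  next
    assume "[p 1, p 2, p 3, p 4] = [3, 4, 1, 2]"
    then show ?thesis by (rule *[of _ "(2, 1)"]) (simp_all add: dihedral_group_def dihedral_perm_def)
  next
    assume "[p 1, p 2, p 3, p 4] = [4, 1, 2, 3]"
    then show ?thesis by (rule *[of _ "(3, 1)"]) (simp_all add: dihedral_group_def dihedral_perm_def)
  next
    assume "[p 1, p 2, p 3, p 4] = [1, 4, 3, 2]"
    then show ?thesis by (rule *[of _ "(2, -1)"]) (simp_all add: dihedral_group_def dihedral_perm_def)
  next
    assume "[p 1, p 2, p 3, p 4] = [2, 1, 4, 3]"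
    then show ?thesis by (rule *[of _ "(3, -1)"]) (simp_all add: dihedral_group_def dihedral_perm_def)
  next
    assume "[p 1, p 2, p 3, p 4] = [3, 2, 1, 4]"
    then show ?thesis by (rule *[of _ "(0, -1)"]) (simp_all add: dihedral_group_def dihedral_perm_def)
  next
    assume "[p 1, p 2, p 3, p 4] = [4, 3, 2, 1]"
    then show ?thesis by (rule *[of _ "(1, -1)"]) (simp_all add: dihedral_group_def dihedral_perm_def)
  qed
qed

section \<open>The three cases\<close>

context quartic_roots
begin

lemma order_eq_card_image: "Coset.order (galois_group f) = card (root_perm ` carrier (galois_group f))"
  by (simp add: Coset.order_def card_image inj_on_root_perm)

lemma root_perm_iso:
  assumes "root_perm ` carrier (galois_group f) = carrier H" "monoid.mult H = (\<circ>)"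
  shows "galois_group f \<cong> H"
proof -
  have "root_perm \<in> iso (galois_group f) H"
    by (rule isoI) (use assms inj_on_root_perm in \<open>auto simp: hom_def bij_betw_def root_perm_mult\<close>)
  then show ?thesis by (auto simp: is_iso_def)
qed

lemma galois_group_alt:
  assumes noroot: "\<And>k. poly resolvent k \<noteq> 0" and square: "256 * d - 27 * a ^ 4 = k ^ 2"
  shows "galois_group f \<cong> alt_group 4"
proof (rule root_perm_iso)
  let ?G = "galois_group f"
  have "vandermonde4 r ^ 2 = (of_int (d * k)) ^ 2"
    unfolding vandermonde4_square disc_def square by (simp add: power_mult_distrib)
  then have "vandermonde4 r = of_int (d * k) \<or> vandermonde4 r = - of_int (d * k)"
    by (simp only: power2_eq_iff)
  then have V: "vandermonde4 r \<in> \<rat>" by (metis Rats_minus_iff Rats_of_int)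
  have even: "root_perm \<sigma> \<in> carrier (alt_group 4)" if s: "\<sigma> \<in> carrier ?G" for \<sigma>
  proof -
    interpret s: complex_embedding "splitting_field f" \<sigma> by (rule galois_group_embedding) fact
    have "vandermonde4 r = of_int (sign (root_perm \<sigma>)) * vandermonde4 r"
      using hom_vandermonde4[OF s] s.hom_Rats[OF V] by simp
    then have "sign (root_perm \<sigma>) = 1" using vandermonde4_nonzero by simp
    then show ?thesis
      using root_perm_permutes[OF s] by (simp add: alt_group_carrier sign_def split: if_splits)
  qed
  have card: "card (carrier (alt_group 4)) = 12"
    using alt_group_card_carrier[of 4] by (simp add: fact_numeral)
  have sub: "root_perm ` carrier ?G \<subseteq> carrier (alt_group 4)" using even by blast
  have fin: "finite (carrier (alt_group 4))" using card by (intro card_ge_0_finite) simp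
  have "12 dvd card (root_perm ` carrier ?G)"
    using twelve_dvd_order[OF noroot] by (simp add: order_eq_card_image)
  moreover have "carrier ?G \<noteq> {}" using group.is_monoid[OF group_galois_group] monoid.one_closed by blast
  then have "0 < card (root_perm ` carrier ?G)" using sub fin by (simp add: card_gt_0_iff finite_subset)
  ultimately have "12 \<le> card (root_perm ` carrier ?G)" by (rule dvd_imp_le)
  then show "root_perm ` carrier ?G = carrier (alt_group 4)"
    using card_seteq[OF fin sub] card by simp
qed (rule alt_group_mult)

lemma galois_group_negate:
  assumes x: "x \<in> splitting_field f" "x ^ 2 = of_int m" and nonsquare: "\<And>k. m \<noteq> k ^ 2"
  shows "\<exists>\<sigma>\<in>carrier (galois_group f). \<sigma> x = - x"
proof (rule galois_group_conjugate[OF f_nonzero x(1)])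
  define h :: "int poly" where "h = [:- m, 0, 1:]"
  have eval: "rat_eval (map_poly rat_of_int h) z = z ^ 2 - of_int m" for z
    unfolding map_poly_of_rat_of_int by (simp add: h_def map_poly_pCons power2_eq_square)
  show "Factorial_Ring.irreducible (map_poly rat_of_int h)"
  proof (rule irreducible_rat_poly_no_root)
    show "poly h k \<noteq> 0" for k using nonsquare[of k] by (simp add: h_def power2_eq_square)
  qed (simp_all add: h_def)
  show "rat_eval (map_poly rat_of_int h) x = 0" "rat_eval (map_poly rat_of_int h) (- x) = 0"
    unfolding eval using x(2) by simp_all
qed

lemma galois_group_sym:
  assumes noroot: "\<And>k. poly resolvent k \<noteq> 0" and nonsquare: "\<not> (\<exists>k. 256 * d - 27 * a ^ 4 = k ^ 2)"
  shows "galois_group f \<cong> sym_group 4"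
proof (rule root_perm_iso)
  let ?G = "galois_group f"
  let ?X = "root_perm ` carrier ?G"
  have "disc \<noteq> k ^ 2" for k
  proof
    assume k: "disc = k ^ 2"
    then have "d ^ 2 dvd k ^ 2" unfolding disc_def by (metis dvd_triv_left)
    then obtain m where "k = d * m" by (auto simp: pow_divides_pow_iff)
    then have "256 * d - 27 * a ^ 4 = m ^ 2" using k d_nonzero by (simp add: disc_def power_mult_distrib)
    then show False using nonsquare by blast
  qed
  then obtain \<sigma> where s: "\<sigma> \<in> carrier ?G" "\<sigma> (vandermonde4 r) = - vandermonde4 r"
    using galois_group_negate[OF vandermonde4_in_splitting_field vandermonde4_square] by blast
  have "of_int (sign (root_perm \<sigma>)) * vandermonde4 r = (-1) * vandermonde4 r"
    using hom_vandermonde4[OF s(1)] s(2) by simp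
  then have odd: "root_perm \<sigma> \<notin> carrier (alt_group 4)"
    using vandermonde4_nonzero by (auto simp: alt_group_carrier sign_def)
  have card: "card (carrier (sym_group 4)) = 24"
    by (simp add: sym_group_card_carrier fact_numeral)
  have fin: "finite (carrier (sym_group 4))" using card by (intro card_ge_0_finite) simp
  have gh: "group_hom ?G (sym_group 4) root_perm"
    by (simp add: group_hom_def group_hom_axioms_def group_galois_group sym_group_is_group root_perm_hom)
  have sg: "subgroup ?X (sym_group 4)" by (rule group_hom.img_is_subgroup[OF gh])
  then have sub: "?X \<subseteq> carrier (sym_group 4)" by (rule subgroup.subset)
  have "card ?X \<noteq> 12"
  proof
    assume X: "card ?X = 12"
    have "carrier (alt_group 4) \<subseteq> ?X"
      using sg by (rule alt_group_subset_index_2) (simp add: X fact_numeral)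
    moreover have "card (carrier (alt_group 4)) = 12"
      using alt_group_card_carrier[of 4] by (simp add: fact_numeral)
    ultimately have "carrier (alt_group 4) = ?X"
      using X finite_subset[OF sub fin] by (intro card_subset_eq) simp_all
    then show False using odd s(1) by blast
  qed
  moreover have "12 dvd card ?X" using twelve_dvd_order[OF noroot] by (simp add: order_eq_card_image)
  moreover have "card ?X \<noteq> 0" using s(1) finite_subset[OF sub fin] by auto
  ultimately have "24 \<le> card ?X" by presburger
  then show "?X = carrier (sym_group 4)" using card_seteq[OF fin sub] card by simp
qed (rule sym_group_mult)

text \<open>
  The root \<open>y\<^sub>2\<close> pairs opposite vertices.  An automorphism that fixes \<open>r\<^sub>1 r\<^sub>3 - r\<^sub>2 r\<^sub>4 = \<plusminus>2i\<close> and
  negates the square root of the discriminant is a transposition, which excludes the cyclic group.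
\<close>
lemma galois_group_dihedral:
  assumes d: "d = 2" and a: "a ^ 2 = 4" and y2: "y2 = -2"
  shows "galois_group f \<cong> dihedral_group 4"
proof -
  let ?G = "galois_group f"
  let ?K = "splitting_field f"
  interpret K: complex_subfield ?K
    unfolding splitting_field_def by (rule complex_subfield_rat_adjoin)
  define V where "V = vandermonde4 r"
  define u where "u = r 1 * r 3 - r 2 * r 4"
  have uK: "u \<in> ?K" unfolding u_def by (intro K.diff_closed K.mult_closed root_in_splitting_field) auto
  have VK: "V \<in> ?K" unfolding V_def by (rule vandermonde4_in_splitting_field)
  have "u ^ 2 = y2 ^ 2 - 4 * (r 1 * r 2 * r 3 * r 4)"
    unfolding u_def y2_def by (simp add: algebra_simps power2_eq_square)
  then have u2: "u ^ 2 = -4" unfolding sym4 y2 d by simp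
  then have u0: "u \<noteq> 0" by auto
  have "a ^ 4 = (a ^ 2) ^ 2" by simp
  then have "d ^ 2 * (256 * d - 27 * a ^ 4) = 320" unfolding d a by simp
  then have "disc = 320" by (simp only: disc_def)
  then have V2: "V ^ 2 = 320" using vandermonde4_square by (simp add: V_def)
  then have V0: "V \<noteq> 0" by auto
  have ns: "(320 :: int) \<noteq> k ^ 2" for k
  proof
    assume k: "320 = k ^ 2"
    have "\<bar>k\<bar> \<le> 17 \<or> 18 \<le> \<bar>k\<bar>" by linarith
    then show False using k power_mono[of "\<bar>k\<bar>" 17 2] power_mono[of 18 "\<bar>k\<bar>" 2] by auto
  qed
  have ns': "(-1280 :: int) \<noteq> k ^ 2" for k
    using zero_le_power2[of k] by linarith
  have pm: "\<sigma> u = u \<or> \<sigma> u = - u" "\<sigma> V = V \<or> \<sigma> V = - V" "\<sigma> (u * V) = \<sigma> u * \<sigma> V" "\<sigma> (- u) = - \<sigma> u"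
    if s: "\<sigma> \<in> carrier ?G" for \<sigma>
  proof -
    interpret s: complex_embedding ?K \<sigma> by (rule galois_group_embedding) fact
    have "\<sigma> u ^ 2 = u ^ 2"
      using s.hom_power[OF uK, of 2] s.hom_of_int[of "-4"] u2 by simp
    then show "\<sigma> u = u \<or> \<sigma> u = - u" by (simp only: power2_eq_iff)
    have "\<sigma> V ^ 2 = V ^ 2"
      using s.hom_power[OF VK, of 2] s.hom_of_int[of 320] V2 by simp
    then show "\<sigma> V = V \<or> \<sigma> V = - V" by (simp only: power2_eq_iff)
    show "\<sigma> (u * V) = \<sigma> u * \<sigma> V" "\<sigma> (- u) = - \<sigma> u" using s.hom_mult uK VK s.hom_uminus by simp_all
  qed
  obtain \<sigma>2 where s2: "\<sigma>2 \<in> carrier ?G" "\<sigma>2 V = - V"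
    using galois_group_negate[of V 320] VK V2 ns by auto
  have "(u * V) ^ 2 = of_int (-1280)" by (simp add: power_mult_distrib u2 V2)
  then obtain \<sigma>3 where s3: "\<sigma>3 \<in> carrier ?G" "\<sigma>3 (u * V) = - (u * V)"
    using galois_group_negate[of "u * V" "-1280"] K.mult_closed[OF uK VK] ns' by blast
  have "\<exists>\<sigma>\<in>carrier ?G. \<sigma> u = u \<and> \<sigma> V = - V"
  proof (cases "\<sigma>2 u = u \<or> \<sigma>3 u = u")
    case True
    then show ?thesis
    proof
      assume "\<sigma>3 u = u"
      then have "u * \<sigma>3 V = u * (- V)" using s3 pm(3)[OF s3(1)] by simp
      then have "\<sigma>3 V = - V" using u0 by (simp only: mult_left_cancel not_False_eq_True)
      then show ?thesis using s3(1) \<open>\<sigma>3 u = u\<close> by (intro bexI[of _ \<sigma>3] conjI)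
    next
      assume "\<sigma>2 u = u"
      then show ?thesis using s2 by (intro bexI[of _ \<sigma>2] conjI)
    qed
  next
    case False
    then have u: "\<sigma>2 u = - u" "\<sigma>3 u = - u" using pm(1)[OF s2(1)] pm(1)[OF s3(1)] by auto
    have "u * \<sigma>3 V = u * V" using s3 pm(3)[OF s3(1)] u(2) by simp
    then have "\<sigma>3 V = V" using u0 by simp
    then have "(\<sigma>2 \<otimes>\<^bsub>?G\<^esub> \<sigma>3) u = u" "(\<sigma>2 \<otimes>\<^bsub>?G\<^esub> \<sigma>3) V = - V"
      using u s2 uK VK pm(4)[OF s2(1)] by (simp_all add: galois_group_mult[OF s2(1) s3(1)] compose_eq)
    moreover have "\<sigma>2 \<otimes>\<^bsub>?G\<^esub> \<sigma>3 \<in> carrier ?G"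
      using group.is_monoid[OF group_galois_group] s2(1) s3(1) by (rule monoid.m_closed)
    ultimately show ?thesis by blast
  qed
  then obtain \<sigma> where s: "\<sigma> \<in> carrier ?G" "\<sigma> u = u" "\<sigma> V = - V" by blast
  have perm_cases: "[p 1, p 2, p 3, p 4] \<in> {[1, 2, 3, 4], [2, 3, 4, 1], [3, 4, 1, 2], [4, 1, 2, 3],
      [1, 4, 3, 2], [2, 1, 4, 3], [3, 2, 1, 4], [4, 3, 2, 1]}"
    if t: "\<tau> \<in> carrier ?G" and p: "p = root_perm \<tau>" for \<tau> p
  proof -
    interpret t: complex_embedding ?K \<tau> by (rule galois_group_embedding) fact
    have perm: "p permutes {1..4}" unfolding p by (rule root_perm_permutes) fact
    have mem: "p 1 \<in> {1, 2, 3, 4}" "p 2 \<in> {1, 2, 3, 4}" "p 3 \<in> {1, 2, 3, 4}" "p 4 \<in> {1, 2, 3, 4}"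
      using permutes_in_image[OF perm] unfolding atLeastAtMost_1_4[symmetric] by auto
    have dist: "p 1 \<noteq> p 2" "p 1 \<noteq> p 3" "p 1 \<noteq> p 4" "p 2 \<noteq> p 3" "p 2 \<noteq> p 4" "p 3 \<noteq> p 4"
      using permutes_inj[OF perm] by (auto simp: inj_eq)
    have "\<tau> y2 = y2" using t.hom_of_int[of "-2"] y2 by simp
    then have y2_fixed: "r (p 1) * r (p 3) + r (p 2) * r (p 4) = y2"
      unfolding y2_def p using root_perm(2)[OF t]
      by (simp add: t.hom_add t.hom_mult root_in_splitting_field K.mult_closed del: One_nat_def)
    have "{p 1, p 3} = {1, 3} \<or> {p 1, p 3} = {2, 4}"
    proof (rule ccontr)
      assume "\<not> ?thesis"
      then have "r (p 1) * r (p 3) + r (p 2) * r (p 4) = y1 \<or> r (p 1) * r (p 3) + r (p 2) * r (p 4) = y3"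
        using mem dist unfolding y1_def y3_def
        by (elim insertE emptyE) (simp_all add: mult.commute add.commute doubleton_eq_iff del: One_nat_def)
      then show False using y2_fixed resolvent_roots_distinct by auto
    qed
    then show ?thesis
      using mem dist by (elim insertE emptyE) (simp_all add: doubleton_eq_iff del: One_nat_def)
  qed
  have "\<exists>i\<in>{1..4}. \<sigma> (r i) = r i"
  proof -
    interpret s: complex_embedding ?K \<sigma> by (rule galois_group_embedding) fact
    define p where "p = root_perm \<sigma>"
    have rp: "\<sigma> (r 1) = r (p 1)" "\<sigma> (r 2) = r (p 2)" "\<sigma> (r 3) = r (p 3)" "\<sigma> (r 4) = r (p 4)"
      using root_perm(2)[OF s(1)] by (simp_all add: p_def)
    have up: "r (p 1) * r (p 3) - r (p 2) * r (p 4) = u"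
      using s(2) rp unfolding u_def
      by (simp add: s.hom_diff s.hom_mult root_in_splitting_field K.mult_closed del: One_nat_def)
    have Vp: "vandermonde4 (r \<circ> p) = - V"
      using s(3) hom_vandermonde4[OF s(1)] vandermonde4_permutes[OF root_perm_permutes[OF s(1)], of r]
      by (simp add: p_def V_def)
    have no: False if "x = u" "x = - u" for x
      using that u0 by simp
    from perm_cases[OF s(1) p_def] have "p 1 = 1 \<or> p 2 = 2"
    proof (elim insertE emptyE)
      assume p: "[p 1, p 2, p 3, p 4] = [3, 4, 1, 2]"
      then have "vandermonde4 (r \<circ> p) = V"
        by (simp add: vandermonde4_def V_def algebra_simps del: One_nat_def)
      then show ?thesis using Vp V0 by simp
    qed (use up no[OF up] in \<open>simp_all add: u_def mult.commute del: One_nat_def\<close>)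
    then show ?thesis using rp by force
  qed
  then obtain i where i: "i \<in> {1..4}" "\<sigma> (r i) = r i" by blast
  have fin: "finite (carrier ?G)"
  proof (rule inj_on_finite[OF inj_on_root_perm])
    show "root_perm ` carrier ?G \<subseteq> carrier (sym_group 4)"
      using root_perm_permutes by (auto simp: sym_group_carrier simp del: One_nat_def)
    show "finite (carrier (sym_group 4))"
      by (rule card_ge_0_finite) (simp add: sym_group_card_carrier)
  qed
  define S where "S = {\<sigma> \<in> carrier ?G. \<sigma> (r i) = r i}"
  have one: "\<one>\<^bsub>?G\<^esub> = (\<lambda>x\<in>?K. x)" by (simp add: galois_group_def BijGroup_def)
  have "\<one>\<^bsub>?G\<^esub> (r i) = r i"
    unfolding one using root_in_splitting_field[OF i(1)] by (rule restrict_apply')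
  then have "\<one>\<^bsub>?G\<^esub> \<in> S"
    using monoid.one_closed[OF group.is_monoid[OF group_galois_group]] by (simp only: S_def mem_Collect_eq simp_thms)
  moreover have "\<sigma> \<in> S" using i s(1) by (simp add: S_def)
  moreover have "\<sigma> \<noteq> \<one>\<^bsub>?G\<^esub>" using s(3) VK V0 by (auto simp: one)
  moreover have "finite S" using fin by (simp add: S_def)
  ultimately have "{\<one>\<^bsub>?G\<^esub>, \<sigma>} \<subseteq> S" "card {\<one>\<^bsub>?G\<^esub>, \<sigma>} = 2" "finite S" by auto
  then have "2 \<le> card S" by (metis card_mono)
  then have ge: "8 \<le> card (root_perm ` carrier ?G)"
    using order_eq_4_times_stabilizer[OF i(1)] order_eq_card_image by (simp add: S_def)
  let ?D = "dihedral_group 4"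
  have sub: "root_perm ` carrier ?G \<subseteq> dihedral_perm ` carrier ?D"
    using dihedral_perm_memI[OF root_perm_permutes perm_cases[OF _ refl]] by blast
  have D: "card (carrier ?D) = 8" using order_dihedral_group[of 4] by (simp add: Coset.order_def)
  have finD: "finite (carrier ?D)" by (simp add: dihedral_group_def)
  have le: "card (dihedral_perm ` carrier ?D) \<le> 8" using card_image_le[OF finD] D by metis
  have eq: "root_perm ` carrier ?G = dihedral_perm ` carrier ?D"
    using sub finD le ge by (intro card_seteq) auto
  then have "card (dihedral_perm ` carrier ?D) = card (carrier ?D)" using le ge D by simp
  then have inj: "inj_on dihedral_perm (carrier ?D)" using finD by (intro eq_card_imp_inj_on)
  interpret D: group ?D by (rule group_dihedral_group) simp
  interpret G: group ?G by (rule group_galois_group)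
  show ?thesis
    by (rule iso_of_common_image[where m = "(\<circ>)", OF inj_on_root_perm inj eq])
      (simp_all add: root_perm_mult dihedral_perm_mult)
qed

end

lemma galois_group_dihedral_2_2:
  assumes f: "f = [:2, 0, 0, a, 1:]" and a: "a = 2 \<or> a = -2"
    and irr: "Factorial_Ring.irreducible (map_poly rat_of_int f)"
  shows "galois_group f \<cong> dihedral_group 4"
proof -
  obtain r where "quartic_roots a 2 f r" using quartic_roots_exist[OF f irr] by auto
  then interpret R: quartic_roots a 2 f r .
  have a2: "a ^ 2 = 4" using a by auto
  have "poly (map_poly of_int R.resolvent) (-2 :: complex) = 0"
    unfolding R.resolvent_def using a by (auto simp: map_poly_pCons)
  then have "R.y1 = -2 \<or> R.y2 = -2 \<or> R.y3 = -2"
    unfolding R.poly_resolvent mult_eq_0_iff right_minus_eq by metis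
  moreover have *: ?thesis if "quartic_roots a 2 f q" "q 1 * q 3 + q 2 * q 4 = -2" for q
    using quartic_roots.galois_group_dihedral[OF that(1)] quartic_roots.y2_def[OF that(1)] that(2) a2 by simp
  moreover have "quartic_roots a 2 f (r(2 := r 3, 3 := r 2))"
    by unfold_locales (use R.f_def R.irr R.sym1 R.sym2 R.sym3 R.sym4 in \<open>simp_all add: algebra_simps\<close>)
  moreover have "quartic_roots a 2 f (r(3 := r 4, 4 := r 3))"
    by unfold_locales (use R.f_def R.irr R.sym1 R.sym2 R.sym3 R.sym4 in \<open>simp_all add: algebra_simps\<close>)
  ultimately show ?thesis
    using *[OF R.quartic_roots_axioms] *[of "r(2 := r 3, 3 := r 2)"] *[of "r(3 := r 4, 4 := r 3)"]
    unfolding R.y1_def R.y2_def R.y3_def by auto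
qed

theorem theorem1p1:
  fixes a d \<delta> :: int and f :: "int poly"
  assumes "a * d \<noteq> 0"
    and "f = [:d, 0, 0, a, 1:]"
    and "\<delta> = 256 * d - 27 * a ^ 4"
    and "monogenic f"
  shows "(galois_group f \<cong> dihedral_group 4 \<longleftrightarrow> (a, d) = (2, 2) \<or> (a, d) = (-2, 2)) \<and>
    (galois_group f \<cong> alt_group 4 \<longleftrightarrow> (\<exists>k::int. \<delta> = k ^ 2)) \<and>
    (galois_group f \<cong> sym_group 4 \<longleftrightarrow>
       \<not> (\<exists>k::int. \<delta> = k ^ 2) \<and> (a, d) \<notin> {(2, 2), (-2, 2)})"
proof -
  have nz: "a \<noteq> 0" "d \<noteq> 0" using assms(1) by auto
  have irr: "Factorial_Ring.irreducible (map_poly rat_of_int f)"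
    using assms(4) by (simp add: monogenic_def)
  have orders: "Coset.order (dihedral_group 4) = 8" "Coset.order (alt_group 4) = 12" "Coset.order (sym_group 4) = 24"
    using order_dihedral_group[of 4] alt_group_card_carrier[of 4] sym_group_card_carrier[of 4]
    by (simp_all add: Coset.order_def fact_numeral)
  have same_order: "Coset.order (galois_group f) = Coset.order H" if "galois_group f \<cong> H" for H :: "('b, 'c) monoid_scheme"
    using that iso_same_order by (auto simp: is_iso_def)
  have special_square: "\<not> (\<exists>k. \<delta> = k ^ 2)" if "(a, d) = (2, 2) \<or> (a, d) = (-2, 2)"
  proof
    assume "\<exists>k. \<delta> = k ^ 2"
    then obtain k where "\<delta> = k ^ 2" ..
    then have k: "80 = k ^ 2" using that assms(3) by auto
    have "\<bar>k\<bar> \<le> 8 \<or> 9 \<le> \<bar>k\<bar>" by linarith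
    then show False using k power_mono[of "\<bar>k\<bar>" 8 2] power_mono[of 9 "\<bar>k\<bar>" 2] by auto
  qed
  show ?thesis
  proof (cases "(a, d) = (2, 2) \<or> (a, d) = (-2, 2)")
    case True
    then have "galois_group f \<cong> dihedral_group 4"
      using assms(2) irr by (intro galois_group_dihedral_2_2[of f a]) auto
    then show ?thesis
      using True special_square same_order[of "dihedral_group 4"] same_order[of "alt_group 4"] same_order[of "sym_group 4"]
      unfolding orders by auto
  next
    case False
    have mono: "monogenic [:d, 0, 0, a, 1:]" using assms(2,4) by simp
    have noroot: "k ^ 3 \<noteq> 4 * d * k + a ^ 2 * d" for k
    proof
      assume root: "k ^ 3 = 4 * d * k + a ^ 2 * d"
      have "(a, d) = (2, 2) \<or> (a, d) = (-2, 2)"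
      proof (rule resolvent_root_imp[OF nz _ _ _ root])
        show "squarefree d"
          by (rule squarefreeI) (rule monogenic_quartic_dvd[OF mono, where n = 0], simp_all)
        show "is_unit q" if q: "odd q" "coprime q d" "q ^ 2 dvd 256 * d - 27 * a ^ 4" for q
        proof -
          have co: "coprime 4 (q ^ 2)" "coprime 256 (q ^ 2)"
            using q(1) coprime_power_left_iff[of 2 2 "q ^ 2"] coprime_power_left_iff[of 2 8 "q ^ 2"] by simp_all
          obtain x y where xy: "x * 4 + y * q ^ 2 = 1"
            using co(1) by (metis bezout_int coprime_imp_gcd_eq_1)
          define n where "n = - 3 * a * x"
          have "4 * n + 3 * a = 3 * a * (1 - x * 4)" by (simp add: n_def algebra_simps)
          also have "1 - x * 4 = q ^ 2 * y" using xy by (simp add: algebra_simps)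
          finally have n: "q ^ 2 dvd 4 * n + 3 * a" by (metis dvd_triv_left dvd_mult)
          show "is_unit q"
          proof (rule monogenic_quartic_dvd[OF mono])
            have "256 * (n ^ 4 + a * n ^ 3 + d) = (4 * n + 3 * a) * (64 * n ^ 3 + 16 * a * n ^ 2 - 12 * a ^ 2 * n + 9 * a ^ 3)
                + (256 * d - 27 * a ^ 4)"
              by (simp add: algebra_simps power2_eq_square power3_eq_cube power4_eq_xxxx)
            then have "q ^ 2 dvd 256 * (n ^ 4 + a * n ^ 3 + d)"
              using n q(3) by (metis dvd_add dvd_mult2)
            then show "q ^ 2 dvd n ^ 4 + a * n ^ 3 + d"
              using co(2) by (metis coprime_commute coprime_dvd_mult_right_iff)
            have "4 * n ^ 3 + 3 * a * n ^ 2 = n ^ 2 * (4 * n + 3 * a)"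
              by (simp add: algebra_simps power2_eq_square power3_eq_cube)
            then show "q dvd 4 * n ^ 3 + 3 * a * n ^ 2"
              using n by (metis dvd_mult dvd_mult_left power2_eq_square)
          qed
        qed
        show "\<not> (4 dvd a \<and> d mod 4 = 3)"
        proof
          assume ad: "4 dvd a \<and> d mod 4 = 3"
          have "is_unit (2 :: int)"
          proof (rule monogenic_quartic_dvd[OF mono])
            show "2 ^ 2 dvd 1 ^ 4 + a * 1 ^ 3 + d" using ad by simp presburger
            show "2 dvd 4 * 1 ^ 3 + 3 * a * 1 ^ 2" using ad by simp presburger
          qed
          then show False by simp
        qed
      qed
      then show False using False by blast
    qed
    obtain r where "quartic_roots a d f r" using quartic_roots_exist[OF assms(2) irr nz(2)] ..
    then interpret R: quartic_roots a d f r .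
    have "poly R.resolvent k \<noteq> 0" for k
      using noroot[of k] by (simp add: R.resolvent_def algebra_simps power2_eq_square power3_eq_cube)
    note alt = R.galois_group_alt[OF this] and sym = R.galois_group_sym[OF this]
    show ?thesis
    proof (cases "\<exists>k. \<delta> = k ^ 2")
      case True
      then obtain k where "256 * d - 27 * a ^ 4 = k ^ 2" unfolding assms(3) ..
      then have "galois_group f \<cong> alt_group 4" by (rule alt)
      then show ?thesis
        using True False same_order[of "dihedral_group 4"] same_order[of "alt_group 4"] same_order[of "sym_group 4"]
        unfolding orders by auto
    next
      case False
      then have "galois_group f \<cong> sym_group 4" unfolding assms(3) by (rule sym)
      then show ?thesis
        using False \<open>\<not> ((a, d) = (2, 2) \<or> (a, d) = (-2, 2))\<close>
          same_order[of "dihedral_group 4"] same_order[of "alt_group 4"] same_order[of "sym_group 4"]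
        unfolding orders by auto
    qed
  qed
qed

end
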